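(* Let $\mathcal{H}$ be a separable complex Hilbert space and let $T \in B(\mathcal{H})$ be a partial isometry. (i) If $\dim \ker T = \dim \ker T^* \leq 1$, then $T$ is a complex symmetric operator. (ii) If $\dim \ker T \neq \dim \ker T^*$, then $T$ is not a complex symmetric operator. (iii) For each $n$ with $2 \leq n \leq \infty$, there exist partial isometries $T$ (on separable complex Hilbert spaces) with $\dim \ker T = \dim \ker T^* = n$ that are complex symmetric, and there also exist partial isometries $T$ with $\dim \ker T = \dim \ker T^* = n$ that are not complex symmetric.
   Context: A partial isometry is an operator $T$ such that $T^*T$ is an orthogonal projection. A conjugation on $\mathcal{H}$ is a conjugate-linear map $C:\mathcal{H}\to\mathcal{H}$ that is isometric and involutive ($C^2=I$). An operator $T$ is complex symmetric if $T = CT^*C$ for some conjugation $C$. *)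

theory Defs
  imports Complex_Main "HOL-Library.Countable_Set" "HOL-Library.Extended_Nat"
begin

text \<open>
  Complex Hilbert spaces are represented explicitly as structures on a carrier set
  inside an ambient type (HOL has no complex inner-product-space class).
  The inner product is linear in the first and conjugate-linear in the second argument.
\<close>

record 'a chspace =
  hs_carrier :: "'a set"
  hs_zero :: 'a
  hs_add :: "'a \<Rightarrow> 'a \<Rightarrow> 'a"
  hs_scale :: "complex \<Rightarrow> 'a \<Rightarrow> 'a"
  hs_inner :: "'a \<Rightarrow> 'a \<Rightarrow> complex"

definition hs_norm :: "'a chspace \<Rightarrow> 'a \<Rightarrow> real" where
  "hs_norm H x = sqrt (Re (hs_inner H x x))"

definition hs_diff :: "'a chspace \<Rightarrow> 'a \<Rightarrow> 'a \<Rightarrow> 'a" where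
  "hs_diff H x y = hs_add H x (hs_scale H (-1) y)"

definition complex_inner_space :: "'a chspace \<Rightarrow> bool" where
  "complex_inner_space H \<longleftrightarrow>
    (let C = hs_carrier H; z = hs_zero H; ad = hs_add H; sc = hs_scale H; ip = hs_inner H in
     z \<in> C \<and>
     (\<forall>x\<in>C. \<forall>y\<in>C. ad x y \<in> C) \<and>
     (\<forall>a. \<forall>x\<in>C. sc a x \<in> C) \<and>
     (\<forall>x\<in>C. \<forall>y\<in>C. \<forall>w\<in>C. ad (ad x y) w = ad x (ad y w)) \<and>
     (\<forall>x\<in>C. \<forall>y\<in>C. ad x y = ad y x) \<and>
     (\<forall>x\<in>C. ad x z = x) \<and>
     (\<forall>x\<in>C. ad x (sc (-1) x) = z) \<and>
     (\<forall>a b. \<forall>x\<in>C. sc a (sc b x) = sc (a * b) x) \<and>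
     (\<forall>x\<in>C. sc 1 x = x) \<and>
     (\<forall>a. \<forall>x\<in>C. \<forall>y\<in>C. sc a (ad x y) = ad (sc a x) (sc a y)) \<and>
     (\<forall>a b. \<forall>x\<in>C. sc (a + b) x = ad (sc a x) (sc b x)) \<and>
     (\<forall>x\<in>C. \<forall>y\<in>C. ip x y = cnj (ip y x)) \<and>
     (\<forall>x\<in>C. \<forall>y\<in>C. \<forall>w\<in>C. ip (ad x y) w = ip x w + ip y w) \<and>
     (\<forall>a. \<forall>x\<in>C. \<forall>y\<in>C. ip (sc a x) y = a * ip x y) \<and>
     (\<forall>x\<in>C. Im (ip x x) = 0 \<and> Re (ip x x) \<ge> 0) \<and>
     (\<forall>x\<in>C. ip x x = 0 \<longrightarrow> x = z))"

definition hilbert_space :: "'a chspace \<Rightarrow> bool" where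
  "hilbert_space H \<longleftrightarrow> complex_inner_space H \<and>
    (\<forall>X :: nat \<Rightarrow> 'a. (\<forall>n. X n \<in> hs_carrier H) \<and>
         (\<forall>e>0. \<exists>N. \<forall>m\<ge>N. \<forall>n\<ge>N. hs_norm H (hs_diff H (X m) (X n)) < e)
       \<longrightarrow> (\<exists>l\<in>hs_carrier H. \<forall>e>0. \<exists>N. \<forall>n\<ge>N. hs_norm H (hs_diff H (X n) l) < e))"

definition separable :: "'a chspace \<Rightarrow> bool" where
  "separable H \<longleftrightarrow> (\<exists>D \<subseteq> hs_carrier H. countable D \<and>
     (\<forall>x\<in>hs_carrier H. \<forall>e>0. \<exists>d\<in>D. hs_norm H (hs_diff H x d) < e))"

text \<open>Bounded (complex-linear) operators; only their values on the carrier matter.\<close>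
definition bounded_op :: "'a chspace \<Rightarrow> ('a \<Rightarrow> 'a) \<Rightarrow> bool" where
  "bounded_op H T \<longleftrightarrow>
     (\<forall>x\<in>hs_carrier H. T x \<in> hs_carrier H) \<and>
     (\<forall>x\<in>hs_carrier H. \<forall>y\<in>hs_carrier H. T (hs_add H x y) = hs_add H (T x) (T y)) \<and>
     (\<forall>a. \<forall>x\<in>hs_carrier H. T (hs_scale H a x) = hs_scale H a (T x)) \<and>
     (\<exists>K. \<forall>x\<in>hs_carrier H. hs_norm H (T x) \<le> K * hs_norm H x)"

text \<open>The Hilbert-space adjoint (unique on the carrier).\<close>
definition adjoint :: "'a chspace \<Rightarrow> ('a \<Rightarrow> 'a) \<Rightarrow> ('a \<Rightarrow> 'a)" where
  "adjoint H T = (SOME S. (\<forall>x\<in>hs_carrier H. S x \<in> hs_carrier H) \<and>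
     (\<forall>x\<in>hs_carrier H. \<forall>y\<in>hs_carrier H. hs_inner H (T x) y = hs_inner H x (S y)))"

definition orth_projection :: "'a chspace \<Rightarrow> ('a \<Rightarrow> 'a) \<Rightarrow> bool" where
  "orth_projection H P \<longleftrightarrow> bounded_op H P \<and>
     (\<forall>x\<in>hs_carrier H. P (P x) = P x) \<and>
     (\<forall>x\<in>hs_carrier H. \<forall>y\<in>hs_carrier H. hs_inner H (P x) y = hs_inner H x (P y))"

definition partial_isometry :: "'a chspace \<Rightarrow> ('a \<Rightarrow> 'a) \<Rightarrow> bool" where
  "partial_isometry H T \<longleftrightarrow> bounded_op H T \<and> orth_projection H (adjoint H T \<circ> T)"

definition conjugation :: "'a chspace \<Rightarrow> ('a \<Rightarrow> 'a) \<Rightarrow> bool" where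
  "conjugation H C \<longleftrightarrow>
     (\<forall>x\<in>hs_carrier H. C x \<in> hs_carrier H) \<and>
     (\<forall>x\<in>hs_carrier H. \<forall>y\<in>hs_carrier H. C (hs_add H x y) = hs_add H (C x) (C y)) \<and>
     (\<forall>a. \<forall>x\<in>hs_carrier H. C (hs_scale H a x) = hs_scale H (cnj a) (C x)) \<and>
     (\<forall>x\<in>hs_carrier H. hs_norm H (C x) = hs_norm H x) \<and>
     (\<forall>x\<in>hs_carrier H. C (C x) = x)"

definition complex_symmetric :: "'a chspace \<Rightarrow> ('a \<Rightarrow> 'a) \<Rightarrow> bool" where
  "complex_symmetric H T \<longleftrightarrow>
     (\<exists>C. conjugation H C \<and> (\<forall>x\<in>hs_carrier H. T x = C (adjoint H T (C x))))"

definition op_kernel :: "'a chspace \<Rightarrow> ('a \<Rightarrow> 'a) \<Rightarrow> 'a set" where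
  "op_kernel H T = {x \<in> hs_carrier H. T x = hs_zero H}"

definition orthonormal :: "'a chspace \<Rightarrow> 'a set \<Rightarrow> bool" where
  "orthonormal H B \<longleftrightarrow> B \<subseteq> hs_carrier H \<and> (\<forall>x\<in>B. hs_inner H x x = 1) \<and>
     (\<forall>x\<in>B. \<forall>y\<in>B. x \<noteq> y \<longrightarrow> hs_inner H x y = 0)"

text \<open>Hilbert dimension of a (closed) subspace, with value \<open>\<infinity>\<close> when infinite.\<close>
definition hdim :: "'a chspace \<Rightarrow> 'a set \<Rightarrow> enat" where
  "hdim H S = Sup {enat (card B) | B. finite B \<and> B \<subseteq> S \<and> orthonormal H B}"

end

theory Submission
  imports Defs
begin

text \<open>
  If the kernels of \<open>T\<close> and \<open>T\<^sup>*\<close> have the same dimension \<open>\<le> 1\<close> and are spanned by \<open>e\<close> and \<open>f\<close>,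
  then \<open>U = T + f \<otimes> e\<close> is unitary. Every unitary \<open>U\<close> and vector \<open>e\<close> admit a conjugation \<open>C\<close> with
  \<open>CUC = U\<^sup>*\<close> and \<open>Ce = e\<close>: decompose the space into orthogonal cyclic subspaces for \<open>U\<close>, one of them
  generated by \<open>e\<close>, and send \<open>U\<^sup>k w\<close> to \<open>U\<^sup>-\<^sup>k w\<close> for each generator \<open>w\<close>; this preserves the Gram
  matrix up to conjugation because \<open>\<langle>U\<^sup>k w, U\<^sup>l w\<rangle>\<close> depends on \<open>k - l\<close> only. Then \<open>UC\<close> symmetrises \<open>T\<close>.
  Conversely, a symmetrising conjugation maps \<open>ker T\<close> isometrically onto \<open>ker T\<^sup>*\<close>. The zero operator is
  the complex symmetric example; the other one contains a five-dimensional partial isometry whose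
  norms \<open>\<parallel>T\<^sup>2 x\<parallel>\<close> and \<open>\<parallel>T\<^sup>*\<^sup>2 y\<parallel>\<close> differ on vectors \<open>x, y\<close> that a conjugation would have to match.
\<close>

section \<open>Complex inner product spaces and Hilbert spaces\<close>

text \<open>No spectral theorem is used: orbits of \<open>U\<close> and a maximal family of
  generators with mutually orthogonal orbits replace the functional model of a unitary operator. The
  condition \<open>C e = e\<close> is what leads back from \<open>U\<close> to \<open>T\<close>. Let
  \<open>S\<close> be the adjoint of \<open>T\<close> and \<open>J = U C\<close>. Then
  \<open>S U = I - e \<otimes> e\<close>, so \<open>J S J = U C (I - e \<otimes> e) C = U - (U e)
  \<otimes> e = T\<close>, and the second equality needs \<open>C\<close> to fix \<open>e\<close>.
  This is also where dimension one enters: a conjugation with \<open>C U C = V\<close> that fixes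
  two vectors \<open>e\<close> and \<open>e'\<close> forces \<langle>U^k e, e'\<rangle> =
  \<langle>U^k e', e\<rangle> for all k, which fails in general. The spans of orbits are not closed,
  so the space is reached from them by limits, and the values of \<open>C\<close> are identified
  through their inner products with the spans. The operator without symmetry has rank three, so
  kernels of dimension n require the ambient dimension n + 3, which is 5 for n = 2. The numbers 3/5
  and 4/5 form a rational pair whose squares add up to 1.\<close>

lemma null_comparison:
  fixes f :: "nat \<Rightarrow> 'b::real_normed_vector"
  assumes "g \<longlonglongrightarrow> 0" "\<And>n. norm (f n) \<le> g n"
  shows "f \<longlonglongrightarrow> 0"
proof (rule tendsto_0_le[OF assms(1), where K = 1], rule eventuallyI)
  show "norm (f n) \<le> norm (g n) * 1" for n
    using assms(2)[of n] by simp
qed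

locale complex_ip =
  fixes H :: "'a chspace"
  assumes inner_space: "complex_inner_space H"
begin

abbreviation carr :: "'a set" where "carr \<equiv> hs_carrier H"
abbreviation zer :: "'a" where "zer \<equiv> hs_zero H"
abbreviation plus_H :: "'a \<Rightarrow> 'a \<Rightarrow> 'a" (infixl "\<oplus>" 65) where "x \<oplus> y \<equiv> hs_add H x y"
abbreviation minus_H :: "'a \<Rightarrow> 'a \<Rightarrow> 'a" (infixl "\<ominus>" 65) where "x \<ominus> y \<equiv> hs_diff H x y"
abbreviation scale_H :: "complex \<Rightarrow> 'a \<Rightarrow> 'a" (infixr "\<odot>" 75) where "a \<odot> x \<equiv> hs_scale H a x"
abbreviation ip :: "'a \<Rightarrow> 'a \<Rightarrow> complex" ("\<langle>_,_\<rangle>") where "\<langle>x,y\<rangle> \<equiv> hs_inner H x y"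
abbreviation nrm :: "'a \<Rightarrow> real" where "nrm \<equiv> hs_norm H"

lemma inner_space_axioms:
  shows ax_zer: "zer \<in> carr"
    and ax_add: "\<forall>x\<in>carr. \<forall>y\<in>carr. x \<oplus> y \<in> carr"
    and ax_scale: "\<forall>a. \<forall>x\<in>carr. a \<odot> x \<in> carr"
    and ax_assoc: "\<forall>x\<in>carr. \<forall>y\<in>carr. \<forall>w\<in>carr. x \<oplus> y \<oplus> w = x \<oplus> (y \<oplus> w)"
    and ax_comm: "\<forall>x\<in>carr. \<forall>y\<in>carr. x \<oplus> y = y \<oplus> x"
    and ax_add_zer: "\<forall>x\<in>carr. x \<oplus> zer = x"
    and ax_neg: "\<forall>x\<in>carr. x \<oplus> (-1) \<odot> x = zer"
    and ax_cnj: "\<forall>x\<in>carr. \<forall>y\<in>carr. \<langle>x,y\<rangle> = cnj \<langle>y,x\<rangle>"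
    and ax_ip_add: "\<forall>x\<in>carr. \<forall>y\<in>carr. \<forall>w\<in>carr. \<langle>x \<oplus> y,w\<rangle> = \<langle>x,w\<rangle> + \<langle>y,w\<rangle>"
    and ax_ip_scale: "\<forall>a. \<forall>x\<in>carr. \<forall>y\<in>carr. \<langle>a \<odot> x,y\<rangle> = a * \<langle>x,y\<rangle>"
    and ax_ip_pos: "\<forall>x\<in>carr. Im \<langle>x,x\<rangle> = 0 \<and> Re \<langle>x,x\<rangle> \<ge> 0"
    and ax_ip_def: "\<forall>x\<in>carr. \<langle>x,x\<rangle> = 0 \<longrightarrow> x = zer"
  using inner_space unfolding complex_inner_space_def Let_def by - (elim conjE, assumption)+

lemma zer_carr [simp]: "zer \<in> carr"
  and add_carr [simp]: "\<lbrakk>x \<in> carr; y \<in> carr\<rbrakk> \<Longrightarrow> x \<oplus> y \<in> carr"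
  and scale_carr [simp]: "x \<in> carr \<Longrightarrow> a \<odot> x \<in> carr"
  using ax_zer ax_add ax_scale by simp_all

lemma ip_commute: "\<lbrakk>x \<in> carr; y \<in> carr\<rbrakk> \<Longrightarrow> \<langle>x,y\<rangle> = cnj \<langle>y,x\<rangle>"
  using ax_cnj by blast

lemma ip_add_left [simp]: "\<lbrakk>x \<in> carr; y \<in> carr; w \<in> carr\<rbrakk> \<Longrightarrow> \<langle>x \<oplus> y,w\<rangle> = \<langle>x,w\<rangle> + \<langle>y,w\<rangle>"
  and ip_scale_left [simp]: "\<lbrakk>x \<in> carr; y \<in> carr\<rbrakk> \<Longrightarrow> \<langle>a \<odot> x,y\<rangle> = a * \<langle>x,y\<rangle>"
  and ip_self_Im [simp]: "x \<in> carr \<Longrightarrow> Im \<langle>x,x\<rangle> = 0"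
  and ip_self_Re [simp]: "x \<in> carr \<Longrightarrow> Re \<langle>x,x\<rangle> \<ge> 0"
  and ip_self_zeroD: "\<lbrakk>x \<in> carr; \<langle>x,x\<rangle> = 0\<rbrakk> \<Longrightarrow> x = zer"
  using ax_ip_add ax_ip_scale ax_ip_pos ax_ip_def by simp_all

lemma diff_carr [simp]: "\<lbrakk>x \<in> carr; y \<in> carr\<rbrakk> \<Longrightarrow> x \<ominus> y \<in> carr"
  by (simp add: hs_diff_def)

lemma ip_diff_left [simp]:
  "\<lbrakk>x \<in> carr; y \<in> carr; w \<in> carr\<rbrakk> \<Longrightarrow> \<langle>x \<ominus> y,w\<rangle> = \<langle>x,w\<rangle> - \<langle>y,w\<rangle>"
  by (simp add: hs_diff_def)

lemma ip_add_right [simp]: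
  "\<lbrakk>x \<in> carr; y \<in> carr; w \<in> carr\<rbrakk> \<Longrightarrow> \<langle>w,x \<oplus> y\<rangle> = \<langle>w,x\<rangle> + \<langle>w,y\<rangle>"
  using ip_commute[of w "x \<oplus> y"] ip_commute[of w x] ip_commute[of w y] by simp

lemma ip_scale_right [simp]:
  "\<lbrakk>x \<in> carr; y \<in> carr\<rbrakk> \<Longrightarrow> \<langle>y,a \<odot> x\<rangle> = cnj a * \<langle>y,x\<rangle>"
  using ip_commute[of y "a \<odot> x"] ip_commute[of y x] by simp

lemma ip_diff_right [simp]:
  "\<lbrakk>x \<in> carr; y \<in> carr; w \<in> carr\<rbrakk> \<Longrightarrow> \<langle>w,x \<ominus> y\<rangle> = \<langle>w,x\<rangle> - \<langle>w,y\<rangle>"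
  by (simp add: hs_diff_def)

lemma scale_zero_left: "x \<in> carr \<Longrightarrow> 0 \<odot> x = zer"
  by (rule ip_self_zeroD) simp_all

lemma ip_zero_left [simp]: "x \<in> carr \<Longrightarrow> \<langle>zer,x\<rangle> = 0"
  using ip_scale_left[of zer x 0] scale_zero_left[of zer] by simp

lemma ip_zero_right [simp]: "x \<in> carr \<Longrightarrow> \<langle>x,zer\<rangle> = 0"
  using ip_commute[of x zer] by simp

text \<open>Associativity, commutativity and negatives are handled here once and for all; later
  vector identities are checked after taking inner products.\<close>

lemma diff_eq_zeroD:
  assumes "x \<in> carr" "y \<in> carr" "x \<ominus> y = zer"
  shows "x = y"
proof -
  have m: "(-1) \<odot> y \<in> carr" using assms(2) by simp
  have "zer \<oplus> y = x \<oplus> ((-1) \<odot> y \<oplus> y)"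
    using ax_assoc[rule_format, OF assms(1) m assms(2)] assms(3) by (simp add: hs_diff_def)
  also have "(-1) \<odot> y \<oplus> y = zer"
    using ax_comm[rule_format, OF m assms(2)] ax_neg[rule_format, OF assms(2)] by simp
  finally show ?thesis
    using ax_comm[rule_format, OF zer_carr assms(2)] ax_add_zer assms(1,2) by simp
qed

text \<open>Turns every linear identity in \<open>H\<close> into one between complex numbers.\<close>
lemma ip_eqI:
  assumes "x \<in> carr" "y \<in> carr" "\<And>w. w \<in> carr \<Longrightarrow> \<langle>x,w\<rangle> = \<langle>y,w\<rangle>"
  shows "x = y"
proof (rule diff_eq_zeroD[OF assms(1,2)], rule ip_self_zeroD)
  show "\<langle>x \<ominus> y,x \<ominus> y\<rangle> = 0" using assms by simp
qed (use assms in simp)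

lemma ip_self_eq: "x \<in> carr \<Longrightarrow> \<langle>x,x\<rangle> = complex_of_real ((nrm x)\<^sup>2)"
  by (simp add: hs_norm_def complex_eq_iff)

lemma nrm_sq: "x \<in> carr \<Longrightarrow> (nrm x)\<^sup>2 = Re \<langle>x,x\<rangle>"
  by (simp add: hs_norm_def)

lemma nrm_ge_0 [simp]: "x \<in> carr \<Longrightarrow> nrm x \<ge> 0"
  by (simp add: hs_norm_def)

lemma ip_swap_eq_0: "\<lbrakk>x \<in> carr; y \<in> carr; \<langle>x,y\<rangle> = 0\<rbrakk> \<Longrightarrow> \<langle>y,x\<rangle> = 0"
  using ip_commute[of y x] by simp

text \<open>The squared distance from \<open>x\<close> to the line through \<open>y\<close>,
  multiplied by the squared norm of \<open>y\<close> to clear denominators. Cauchy-Schwarz, the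
  nearest-point argument and Bessel's inequality all start from it.\<close>

lemma orth_residual_sq:
  assumes "x \<in> carr" "y \<in> carr" "\<langle>y,y\<rangle> \<noteq> 0"
  shows "Re \<langle>x \<ominus> (\<langle>x,y\<rangle> / \<langle>y,y\<rangle>) \<odot> y, x \<ominus> (\<langle>x,y\<rangle> / \<langle>y,y\<rangle>) \<odot> y\<rangle> * (nrm y)\<^sup>2
     = (nrm x)\<^sup>2 * (nrm y)\<^sup>2 - (cmod \<langle>x,y\<rangle>)\<^sup>2"
proof -
  define z r c where "z = \<langle>x,y\<rangle>" and "r = (nrm y)\<^sup>2" and "c = z / of_real r"
  have yy: "\<langle>y,y\<rangle> = of_real r" and xx: "\<langle>x,x\<rangle> = of_real ((nrm x)\<^sup>2)" and yx: "\<langle>y,x\<rangle> = cnj z"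
    using assms ip_self_eq ip_commute unfolding r_def z_def by blast+
  have r: "r \<noteq> 0" using assms(3) yy by auto
  have "\<langle>x \<ominus> c \<odot> y, x \<ominus> c \<odot> y\<rangle> * of_real r
      = of_real ((nrm x)\<^sup>2) * of_real r - cnj c * of_real r * z - c * of_real r * cnj z
        + (c * of_real r) * (cnj c * of_real r)"
    using assms(1,2) by (simp add: yy xx yx z_def[symmetric] algebra_simps)
  also have "\<dots> = of_real ((nrm x)\<^sup>2 * r) - z * cnj z"
    using r by (simp add: c_def)
  also have "\<dots> = of_real ((nrm x)\<^sup>2 * r - (cmod z)\<^sup>2)"
    by (simp only: of_real_diff complex_norm_square)
  finally have "Re (\<langle>x \<ominus> c \<odot> y, x \<ominus> c \<odot> y\<rangle> * of_real r) = (nrm x)\<^sup>2 * r - (cmod z)\<^sup>2"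
    by (simp only: Re_complex_of_real)
  then show ?thesis
    unfolding yy z_def[symmetric] r_def[symmetric] c_def[symmetric]
    by simp
qed

lemma Cauchy_Schwarz:
  assumes "x \<in> carr" "y \<in> carr"
  shows "cmod \<langle>x,y\<rangle> \<le> nrm x * nrm y"
proof (cases "\<langle>y,y\<rangle> = 0")
  case True
  then have "y = zer" using assms ip_self_zeroD by blast
  then show ?thesis using assms by simp
next
  case False
  have "0 \<le> Re \<langle>x \<ominus> (\<langle>x,y\<rangle> / \<langle>y,y\<rangle>) \<odot> y, x \<ominus> (\<langle>x,y\<rangle> / \<langle>y,y\<rangle>) \<odot> y\<rangle> * (nrm y)\<^sup>2"
    using assms by (intro mult_nonneg_nonneg ip_self_Re diff_carr scale_carr) auto
  then have "(cmod \<langle>x,y\<rangle>)\<^sup>2 \<le> (nrm x * nrm y)\<^sup>2"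
    using orth_residual_sq[OF assms False] by (simp add: power_mult_distrib)
  then show ?thesis
    using assms by (simp add: power2_le_iff_abs_le)
qed

section \<open>Limits, Cauchy sequences and subspaces\<close>

definition tends :: "(nat \<Rightarrow> 'a) \<Rightarrow> 'a \<Rightarrow> bool" where
  "tends X l \<longleftrightarrow> (\<lambda>n. nrm (X n \<ominus> l)) \<longlonglongrightarrow> 0"

lemma tends_ip_left:
  assumes "\<And>n. X n \<in> carr" "x \<in> carr" "y \<in> carr" "tends X x"
  shows "(\<lambda>n. \<langle>X n,y\<rangle>) \<longlonglongrightarrow> \<langle>x,y\<rangle>"
proof -
  have "(\<lambda>n. nrm (X n \<ominus> x) * nrm y) \<longlonglongrightarrow> 0"
    using assms(4) unfolding tends_def by (rule tendsto_mult_left_zero)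
  moreover have "norm (\<langle>X n,y\<rangle> - \<langle>x,y\<rangle>) \<le> nrm (X n \<ominus> x) * nrm y" for n
    using Cauchy_Schwarz[of "X n \<ominus> x" y] assms by simp
  ultimately have "(\<lambda>n. \<langle>X n,y\<rangle> - \<langle>x,y\<rangle>) \<longlonglongrightarrow> 0"
    by (rule null_comparison)
  then show ?thesis by (simp add: LIM_zero_iff)
qed

lemma tends_ip_self:
  assumes "\<And>n. X n \<in> carr" "x \<in> carr" "tends X x"
  shows "(\<lambda>n. \<langle>X n,X n\<rangle>) \<longlonglongrightarrow> \<langle>x,x\<rangle>"
proof -
  \<comment> \<open>Expanding the square reduces the claim to continuity in one argument.\<close>
  have *: "\<langle>X n,X n\<rangle> = complex_of_real ((nrm (X n \<ominus> x))\<^sup>2) + \<langle>X n,x\<rangle> + cnj \<langle>X n,x\<rangle> - \<langle>x,x\<rangle>" for n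
    using assms ip_self_eq[of "X n \<ominus> x"] ip_commute[of x "X n"] by (simp add: algebra_simps)
  have "(\<lambda>n. complex_of_real ((nrm (X n \<ominus> x))\<^sup>2) + \<langle>X n,x\<rangle> + cnj \<langle>X n,x\<rangle> - \<langle>x,x\<rangle>)
      \<longlonglongrightarrow> complex_of_real (0\<^sup>2) + \<langle>x,x\<rangle> + cnj \<langle>x,x\<rangle> - \<langle>x,x\<rangle>"
    using assms unfolding tends_def
    by (intro tendsto_intros tends_ip_left) (auto simp: tends_def)
  moreover have "complex_of_real (0\<^sup>2) + \<langle>x,x\<rangle> + cnj \<langle>x,x\<rangle> - \<langle>x,x\<rangle> = \<langle>x,x\<rangle>"
    using assms ip_commute[of x x] by simp
  ultimately show ?thesis unfolding * by simp
qed

definition Cauchy_H :: "(nat \<Rightarrow> 'a) \<Rightarrow> bool" where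
  "Cauchy_H X \<longleftrightarrow> (\<forall>e>0. \<exists>N. \<forall>m\<ge>N. \<forall>n\<ge>N. nrm (X m \<ominus> X n) < e)"

definition subspace :: "'a set \<Rightarrow> bool" where
  "subspace M \<longleftrightarrow> M \<subseteq> carr \<and> zer \<in> M \<and> (\<forall>x\<in>M. \<forall>y\<in>M. x \<oplus> y \<in> M) \<and> (\<forall>a. \<forall>x\<in>M. a \<odot> x \<in> M)"

lemma subspace_diff: "\<lbrakk>subspace M; x \<in> M; y \<in> M\<rbrakk> \<Longrightarrow> x \<ominus> y \<in> M"
  by (simp add: subspace_def hs_diff_def)

text \<open>The parallelogram law for x - p and x - q, written with the midpoint of \<open>p\<close>
  and \<open>q\<close> because a subspace contains that midpoint.\<close>

lemma parallelogram_mid: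
  assumes "x \<in> carr" "p \<in> carr" "q \<in> carr"
  shows "(nrm (p \<ominus> q))\<^sup>2 + 4 * (nrm (x \<ominus> (1/2) \<odot> (p \<oplus> q)))\<^sup>2
    = 2 * (nrm (x \<ominus> p))\<^sup>2 + 2 * (nrm (x \<ominus> q))\<^sup>2"
  using assms by (simp add: nrm_sq algebra_simps)

end

locale complex_hilbert = complex_ip +
  assumes hilbert: "hilbert_space H"
begin

section \<open>Nearest points and the Riesz representation\<close>

lemma complete:
  assumes "\<And>n. X n \<in> carr" "Cauchy_H X"
  obtains l where "l \<in> carr" "tends X l"
proof -
  have "\<exists>l\<in>carr. \<forall>e>0. \<exists>N. \<forall>n\<ge>N. nrm (X n \<ominus> l) < e"
    using hilbert assms unfolding hilbert_space_def Cauchy_H_def by blast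
  then obtain l where l: "l \<in> carr" "\<forall>e>0. \<exists>N. \<forall>n\<ge>N. nrm (X n \<ominus> l) < e" by blast
  have "tends X l"
    unfolding tends_def using l assms by (intro LIMSEQ_I) simp
  with l that show thesis by blast
qed

text \<open>Since \<open>M\<close> need not be closed, the foot \<open>p\<close> of the
  perpendicular is only a limit of a minimising sequence in \<open>M\<close>. The sequence is part
  of the conclusion because functionals and conjugations are later carried along it.\<close>

lemma approximate_projection:
  assumes M: "subspace M" and x: "x \<in> carr"
  shows "\<exists>X p. (\<forall>n. X n \<in> M) \<and> Cauchy_H X \<and> p \<in> carr \<and> tends X p \<and> (\<forall>m\<in>M. \<langle>x \<ominus> p,m\<rangle> = 0)"
proof -
  have Mc: "m \<in> carr" if "m \<in> M" for m using M that by (auto simp: subspace_def)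
  define D where "D = (\<lambda>m. (nrm (x \<ominus> m))\<^sup>2) ` M"
  define d where "d = Inf D"
  have bdd: "bdd_below D" unfolding D_def by (intro bdd_belowI[of _ 0]) auto
  have ne: "D \<noteq> {}" using M by (auto simp: D_def subspace_def)
  have d_le: "d \<le> (nrm (x \<ominus> m))\<^sup>2" if "m \<in> M" for m
    unfolding d_def using bdd that by (intro cInf_lower) (auto simp: D_def)
  have "\<exists>m\<in>M. (nrm (x \<ominus> m))\<^sup>2 < d + 1 / real (Suc n)" for n
  proof -
    have "Inf D < d + 1 / real (Suc n)" by (simp add: d_def)
    then show ?thesis using cInf_lessD[OF ne] unfolding D_def by blast
  qed
  then obtain X where XM: "\<And>n. X n \<in> M" and X: "\<And>n. (nrm (x \<ominus> X n))\<^sup>2 < d + 1 / real (Suc n)"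
    by metis
  have Xc: "X n \<in> carr" for n using Mc XM by blast
  have "Cauchy_H X"
    unfolding Cauchy_H_def
  proof (intro allI impI)
    fix e :: real assume e: "e > 0"
    then obtain N where N: "inverse (real (Suc N)) < e\<^sup>2 / 4"
      using reals_Archimedean[of "e\<^sup>2 / 4"] by auto
    have "nrm (X m \<ominus> X n) < e" if mn: "m \<ge> N" "n \<ge> N" for m n
    proof -
      \<comment> \<open>The midpoint has squared distance at least \<open>d\<close> from
        \<open>x\<close>, so the parallelogram law leaves only twice the two errors of the
        minimising sequence.\<close>
      have "(1/2) \<odot> (X m \<oplus> X n) \<in> M" using M XM by (simp add: subspace_def)
      then have "(nrm (X m \<ominus> X n))\<^sup>2 + 4 * d \<le> 2 * (nrm (x \<ominus> X m))\<^sup>2 + 2 * (nrm (x \<ominus> X n))\<^sup>2"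
        using parallelogram_mid[OF x Xc[of m] Xc[of n]] d_le[of "(1/2) \<odot> (X m \<oplus> X n)"] by linarith
      also have "\<dots> < 2 * (d + 1 / real (Suc m)) + 2 * (d + 1 / real (Suc n))"
        using X[of m] X[of n] by (intro add_strict_mono mult_strict_left_mono) auto
      finally have "(nrm (X m \<ominus> X n))\<^sup>2 < 2 / real (Suc m) + 2 / real (Suc n)" by simp
      also have "\<dots> \<le> 2 / real (Suc N) + 2 / real (Suc N)"
        using mn by (intro add_mono divide_left_mono) auto
      also have "\<dots> = 4 * inverse (real (Suc N))" by (simp add: divide_inverse)
      also have "\<dots> < e\<^sup>2" using N by linarith
      finally show ?thesis using e by (simp add: power_less_imp_less_base)
    qed
    then show "\<exists>N. \<forall>m\<ge>N. \<forall>n\<ge>N. nrm (X m \<ominus> X n) < e" by blast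
  qed
  moreover from complete[OF Xc this] obtain p where p: "p \<in> carr" "tends X p" by blast
  moreover have "\<langle>x \<ominus> p,m\<rangle> = 0" if m: "m \<in> M" for m
  proof (cases "\<langle>m,m\<rangle> = 0")
    case True
    then have "m = zer" using ip_self_zeroD[OF Mc[OF m]] by blast
    then show ?thesis using p x by simp
  next
    case False
    have mc: "m \<in> carr" using Mc m .
    have bound: "(cmod \<langle>x \<ominus> X n,m\<rangle>)\<^sup>2 \<le> (nrm m)\<^sup>2 * (1 / real (Suc n))" for n
    proof -
      \<comment> \<open>Moving \<open>X n\<close> by the best multiple of \<open>m\<close> stays in
        \<open>M\<close> and cannot bring the squared distance below \<open>d\<close>; this bounds
        the component of x - X n along \<open>m\<close>.\<close>
      define c where "c = \<langle>x \<ominus> X n,m\<rangle> / \<langle>m,m\<rangle>"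
      have eq: "(x \<ominus> X n) \<ominus> c \<odot> m = x \<ominus> (X n \<oplus> c \<odot> m)"
        using x Xc mc by (intro ip_eqI) auto
      have "X n \<oplus> c \<odot> m \<in> M" using M XM m by (simp add: subspace_def)
      then have "d \<le> Re \<langle>(x \<ominus> X n) \<ominus> c \<odot> m,(x \<ominus> X n) \<ominus> c \<odot> m\<rangle>"
        unfolding eq using d_le[of "X n \<oplus> c \<odot> m"] nrm_sq[of "x \<ominus> (X n \<oplus> c \<odot> m)"] x Xc mc by simp
      then have "d * (nrm m)\<^sup>2 \<le> Re \<langle>(x \<ominus> X n) \<ominus> c \<odot> m,(x \<ominus> X n) \<ominus> c \<odot> m\<rangle> * (nrm m)\<^sup>2"
        by (rule mult_right_mono) simp
      also have "\<dots> = (nrm (x \<ominus> X n))\<^sup>2 * (nrm m)\<^sup>2 - (cmod \<langle>x \<ominus> X n,m\<rangle>)\<^sup>2"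
        unfolding c_def by (rule orth_residual_sq[OF diff_carr[OF x Xc] mc False])
      finally have "d * (nrm m)\<^sup>2 \<le> (nrm (x \<ominus> X n))\<^sup>2 * (nrm m)\<^sup>2 - (cmod \<langle>x \<ominus> X n,m\<rangle>)\<^sup>2" .
      moreover have "(nrm (x \<ominus> X n))\<^sup>2 * (nrm m)\<^sup>2 \<le> (d + 1 / real (Suc n)) * (nrm m)\<^sup>2"
        using X[of n] by (intro mult_right_mono) auto
      ultimately show ?thesis by (simp add: algebra_simps)
    qed
    have "(\<lambda>n. (nrm m)\<^sup>2 * (1 / real (Suc n))) \<longlonglongrightarrow> 0"
      by (intro tendsto_mult_right_zero LIMSEQ_Suc[OF lim_1_over_n])
    then have "(\<lambda>n. (cmod (\<langle>x,m\<rangle> - \<langle>X n,m\<rangle>))\<^sup>2) \<longlonglongrightarrow> 0"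
      by (rule null_comparison) (use bound x Xc mc in simp)
    moreover have "(\<lambda>n. (cmod (\<langle>x,m\<rangle> - \<langle>X n,m\<rangle>))\<^sup>2) \<longlonglongrightarrow> (cmod (\<langle>x,m\<rangle> - \<langle>p,m\<rangle>))\<^sup>2"
      using p Xc mc by (intro tendsto_power tendsto_norm tendsto_diff tendsto_const tends_ip_left) auto
    ultimately have "(cmod (\<langle>x,m\<rangle> - \<langle>p,m\<rangle>))\<^sup>2 = 0"
      by (rule LIMSEQ_unique[rotated])
    then show ?thesis using x p mc by simp
  qed
  ultimately show ?thesis using XM by blast
qed

text \<open>Boundedness makes \<open>f\<close> vanish at the limit \<open>p\<close> of kernel
  vectors, so \<open>w = x0 \<ominus> p\<close> is orthogonal to the kernel while
  \<open>f w \<noteq> 0\<close>. Every \<open>x\<close> differs from a multiple of \<open>w\<close>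
  by a kernel vector, which determines \<open>f\<close>.\<close>

lemma Riesz_representation:
  assumes add: "\<And>x y. \<lbrakk>x \<in> carr; y \<in> carr\<rbrakk> \<Longrightarrow> f (x \<oplus> y) = f x + f y"
    and scale: "\<And>a x. x \<in> carr \<Longrightarrow> f (a \<odot> x) = a * f x"
    and bdd: "\<And>x. x \<in> carr \<Longrightarrow> cmod (f x) \<le> K * nrm x"
  shows "\<exists>y\<in>carr. \<forall>x\<in>carr. f x = \<langle>x,y\<rangle>"
proof (cases "\<forall>x\<in>carr. f x = 0")
  case True
  then show ?thesis by (intro bexI[of _ zer]) auto
next
  case False
  then obtain x0 where x0: "x0 \<in> carr" "f x0 \<noteq> 0" by blast
  have diff: "f (x \<ominus> y) = f x - f y" if "x \<in> carr" "y \<in> carr" for x y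
    using that by (simp add: hs_diff_def add scale)
  have zer: "f zer = 0" using scale[of zer 0] scale_zero_left[of zer] by simp
  define M where "M = {x \<in> carr. f x = 0}"
  have M_sub: "subspace M" unfolding subspace_def M_def using add scale zer by auto
  obtain X p where X: "\<And>n. X n \<in> M" "Cauchy_H X" "p \<in> carr" "tends X p"
    and orth: "\<And>m. m \<in> M \<Longrightarrow> \<langle>x0 \<ominus> p,m\<rangle> = 0"
    using approximate_projection[OF M_sub x0(1)] by blast
  have "norm (f p) \<le> K * nrm (X n \<ominus> p)" for n
    using bdd[of "X n \<ominus> p"] X diff[of "X n" p] by (auto simp: M_def)
  moreover have "(\<lambda>n. K * nrm (X n \<ominus> p)) \<longlonglongrightarrow> 0"
    using X(4) unfolding tends_def by (rule tendsto_mult_right_zero)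
  ultimately have "norm (f p) \<le> 0"
    using LIMSEQ_le_const by blast
  then have fp: "f p = 0" by simp
  define w where "w = x0 \<ominus> p"
  have w: "w \<in> carr" "f w \<noteq> 0" using x0 X fp diff by (auto simp: w_def)
  have ww: "\<langle>w,w\<rangle> \<noteq> 0" using ip_self_zeroD[OF w(1)] w zer by auto
  have "f x = \<langle>x, cnj (f w / \<langle>w,w\<rangle>) \<odot> w\<rangle>" if x: "x \<in> carr" for x
  proof -
    have "x \<ominus> (f x / f w) \<odot> w \<in> M" using x w diff scale by (simp add: M_def)
    then have "\<langle>w, x \<ominus> (f x / f w) \<odot> w\<rangle> = 0"
      unfolding w_def by (rule orth)
    then have "\<langle>x \<ominus> (f x / f w) \<odot> w, w\<rangle> = 0"
      by (rule ip_swap_eq_0[rotated 2]) (use x w in simp_all)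
    then have xw: "\<langle>x,w\<rangle> = f x / f w * \<langle>w,w\<rangle>" using x w by simp
    have "\<langle>x, cnj (f w / \<langle>w,w\<rangle>) \<odot> w\<rangle> = f w / \<langle>w,w\<rangle> * \<langle>x,w\<rangle>"
      using x w by (simp only: ip_scale_right complex_cnj_cnj)
    also have "\<dots> = f x" unfolding xw using w(2) ww by simp
    finally show ?thesis ..
  qed
  then show ?thesis
    using scale_carr[OF w(1)] by (intro bexI[where x = "cnj (f w / \<langle>w,w\<rangle>) \<odot> w"] ballI)
qed

end

section \<open>Adjoints and conjugations\<close>

context complex_hilbert
begin

lemma adjoint_exists:
  assumes "bounded_op H T"
  shows "\<exists>S. (\<forall>x\<in>carr. S x \<in> carr) \<and> (\<forall>x\<in>carr. \<forall>y\<in>carr. \<langle>T x,y\<rangle> = \<langle>x,S y\<rangle>)"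
proof -
  from assms obtain K where T: "\<And>x. x \<in> carr \<Longrightarrow> T x \<in> carr"
      "\<And>x y. \<lbrakk>x \<in> carr; y \<in> carr\<rbrakk> \<Longrightarrow> T (x \<oplus> y) = T x \<oplus> T y"
      "\<And>a x. x \<in> carr \<Longrightarrow> T (a \<odot> x) = a \<odot> T x"
      "\<And>x. x \<in> carr \<Longrightarrow> nrm (T x) \<le> K * nrm x"
    unfolding bounded_op_def by blast
  have "\<exists>z\<in>carr. \<forall>x\<in>carr. \<langle>T x,y\<rangle> = \<langle>x,z\<rangle>" if y: "y \<in> carr" for y
  proof (rule Riesz_representation[where K = "K * nrm y"])
    fix x assume x: "x \<in> carr"
    have "cmod \<langle>T x,y\<rangle> \<le> nrm (T x) * nrm y" using x y T(1) by (intro Cauchy_Schwarz)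
    also have "\<dots> \<le> (K * nrm x) * nrm y" using x y T(4) by (intro mult_right_mono) auto
    finally show "cmod \<langle>T x,y\<rangle> \<le> K * nrm y * nrm x" by (simp add: mult_ac)
  qed (use T y in auto)
  then obtain S where "\<forall>y\<in>carr. S y \<in> carr \<and> (\<forall>x\<in>carr. \<langle>T x,y\<rangle> = \<langle>x,S y\<rangle>)"
    by metis
  then show ?thesis by blast
qed

lemma
  assumes "bounded_op H T"
  shows adjoint_carr: "y \<in> carr \<Longrightarrow> adjoint H T y \<in> carr"
    and ip_adjoint: "\<lbrakk>x \<in> carr; y \<in> carr\<rbrakk> \<Longrightarrow> \<langle>T x,y\<rangle> = \<langle>x,adjoint H T y\<rangle>"
  using someI_ex[OF adjoint_exists[OF assms], folded adjoint_def] by simp_all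

end

context complex_ip
begin

text \<open>The map \<open>S\<close> itself witnesses the existence behind the choice in
  \<open>adjoint\<close>, so the argument works in every inner product space; uniqueness is
  \<open>ip_eqI\<close>.\<close>

lemma adjoint_eqI:
  assumes S: "\<And>x. x \<in> carr \<Longrightarrow> S x \<in> carr"
    and ST: "\<And>x y. \<lbrakk>x \<in> carr; y \<in> carr\<rbrakk> \<Longrightarrow> \<langle>T x,y\<rangle> = \<langle>x,S y\<rangle>"
    and y: "y \<in> carr"
  shows "adjoint H T y = S y"
proof -
  have "\<exists>S. (\<forall>x\<in>carr. S x \<in> carr) \<and> (\<forall>x\<in>carr. \<forall>y\<in>carr. \<langle>T x,y\<rangle> = \<langle>x,S y\<rangle>)"
    using S ST by blast
  from someI_ex[OF this] have A: "adjoint H T y \<in> carr" "\<And>x. x \<in> carr \<Longrightarrow> \<langle>T x,y\<rangle> = \<langle>x,adjoint H T y\<rangle>"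
    unfolding adjoint_def[symmetric] using y by blast+
  show ?thesis
  proof (rule ip_eqI)
    fix w assume w: "w \<in> carr"
    have "\<langle>w,adjoint H T y\<rangle> = \<langle>w,S y\<rangle>" using A(2)[OF w] ST[OF w y] by simp
    then show "\<langle>adjoint H T y,w\<rangle> = \<langle>S y,w\<rangle>"
      using ip_commute[of "adjoint H T y" w] ip_commute[of "S y" w] w A(1) S[OF y] by simp
  qed (use A S y in auto)
qed

lemma nrm_eq_iff: "\<lbrakk>x \<in> carr; y \<in> carr\<rbrakk> \<Longrightarrow> nrm x = nrm y \<longleftrightarrow> \<langle>x,x\<rangle> = \<langle>y,y\<rangle>"
  by (auto simp: hs_norm_def complex_eq_iff)

lemma conjugation_carr: "\<lbrakk>conjugation H C; x \<in> carr\<rbrakk> \<Longrightarrow> C x \<in> carr"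
  and conjugation_add: "\<lbrakk>conjugation H C; x \<in> carr; y \<in> carr\<rbrakk> \<Longrightarrow> C (x \<oplus> y) = C x \<oplus> C y"
  and conjugation_scale: "\<lbrakk>conjugation H C; x \<in> carr\<rbrakk> \<Longrightarrow> C (a \<odot> x) = cnj a \<odot> C x"
  and conjugation_nrm: "\<lbrakk>conjugation H C; x \<in> carr\<rbrakk> \<Longrightarrow> nrm (C x) = nrm x"
  and conjugation_invol: "\<lbrakk>conjugation H C; x \<in> carr\<rbrakk> \<Longrightarrow> C (C x) = x"
  by (simp_all add: conjugation_def)

lemma conjugation_zero: "conjugation H C \<Longrightarrow> C zer = zer"
  using conjugation_scale[of C zer 0] conjugation_carr[of C zer] scale_zero_left by simp

text \<open>Polarisation: isometry on sums gives equality of real parts, and conjugate-linearity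
  supplies the imaginary parts.\<close>

lemma conjugation_ip:
  assumes C: "conjugation H C" and x: "x \<in> carr" and y: "y \<in> carr"
  shows "\<langle>C x,C y\<rangle> = cnj \<langle>x,y\<rangle>"
proof -
  note Cs = conjugation_carr[OF C] conjugation_add[OF C] conjugation_scale[OF C]
  have self: "\<langle>C z,C z\<rangle> = \<langle>z,z\<rangle>" if "z \<in> carr" for z
    using conjugation_nrm[OF C that] that by (simp add: nrm_eq_iff Cs)
  have Re_eq: "Re \<langle>C x,C z\<rangle> = Re \<langle>x,z\<rangle>" if z: "z \<in> carr" for z
  proof -
    have "\<langle>C (x \<oplus> z),C (x \<oplus> z)\<rangle> = \<langle>x \<oplus> z,x \<oplus> z\<rangle>" using x z by (intro self) simp
    then have "\<langle>C x,C z\<rangle> + \<langle>C z,C x\<rangle> = \<langle>x,z\<rangle> + \<langle>z,x\<rangle>"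
      using x z self[OF x] self[OF z] by (simp add: Cs algebra_simps)
    then have "Re (\<langle>C x,C z\<rangle> + \<langle>C z,C x\<rangle>) = Re (\<langle>x,z\<rangle> + \<langle>z,x\<rangle>)" by simp
    then show ?thesis
      using ip_commute[of z x] ip_commute[of "C z" "C x"] x z by (simp add: Cs)
  qed
  show ?thesis
    \<comment> \<open>Replacing \<open>y\<close> by \<i> times \<open>y\<close> turns the statement
      on real parts into the one on imaginary parts; the sign changes because \<open>C\<close> is
      conjugate-linear.\<close>
    using Re_eq[OF y] Re_eq[of "\<i> \<odot> y"] x y by (simp add: Cs complex_eq_iff)
qed

lemma conjugation_orthonormal_card:
  assumes C: "conjugation H C" and B: "orthonormal H B"
  shows "orthonormal H (C ` B)" "card (C ` B) = card B"
proof -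
  have Bc: "x \<in> carr" if "x \<in> B" for x using B that by (auto simp: orthonormal_def)
  have ip: "\<langle>C x,C y\<rangle> = cnj \<langle>x,y\<rangle>" if "x \<in> B" "y \<in> B" for x y
    using that by (intro conjugation_ip[OF C] Bc)
  show "card (C ` B) = card B"
  proof (rule card_image, rule inj_on_inverseI)
    show "C (C x) = x" if "x \<in> B" for x using conjugation_invol[OF C Bc[OF that]] .
  qed
  show "orthonormal H (C ` B)"
    unfolding orthonormal_def
  proof (intro conjI ballI impI subsetI)
    show "x \<in> carr" if "x \<in> C ` B" for x
      using that Bc conjugation_carr[OF C] by blast
    show "\<langle>x,x\<rangle> = 1" if "x \<in> C ` B" for x
      using that B by (auto simp: ip orthonormal_def)
    show "\<langle>x,y\<rangle> = 0" if "x \<in> C ` B" "y \<in> C ` B" "x \<noteq> y" for x y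
    proof -
      from that(1,2) obtain u v where u: "u \<in> B" "x = C u" and v: "v \<in> B" "y = C v" by blast
      then have "\<langle>u,v\<rangle> = 0" using B that(3) unfolding orthonormal_def by metis
      then show ?thesis using ip[OF u(1) v(1)] u v by simp
    qed
  qed
qed

lemma hdim_le_conjugation:
  assumes C: "conjugation H C" and S: "S \<subseteq> carr" "\<And>x. x \<in> S \<Longrightarrow> C x \<in> S'"
  shows "hdim H S \<le> hdim H S'"
  unfolding hdim_def
proof (rule Sup_mono, safe)
  fix B assume B: "finite B" "B \<subseteq> S" "orthonormal H B"
  then have "enat (card B) = enat (card (C ` B)) \<and> finite (C ` B) \<and> C ` B \<subseteq> S' \<and> orthonormal H (C ` B)"
    using conjugation_orthonormal_card[OF C B(3)] S by auto
  then show "\<exists>b\<in>{enat (card B) |B. finite B \<and> B \<subseteq> S' \<and> orthonormal H B}. enat (card B) \<le> b"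
    by (intro bexI[of _ "enat (card B)"]) auto
qed

end

context complex_hilbert
begin

lemma complex_symmetric_hdim_kernel:
  assumes T: "bounded_op H T" and cs: "complex_symmetric H T"
  shows "hdim H (op_kernel H T) = hdim H (op_kernel H (adjoint H T))"
proof -
  obtain C where C: "conjugation H C" and TC: "\<And>x. x \<in> carr \<Longrightarrow> T x = C (adjoint H T (C x))"
    using cs unfolding complex_symmetric_def by blast
  note Cc = conjugation_carr[OF C] and CC = conjugation_invol[OF C] and C0 = conjugation_zero[OF C]
  have "C x \<in> op_kernel H (adjoint H T)" if "x \<in> op_kernel H T" for x
    using that TC[of x] CC[of "adjoint H T (C x)"] adjoint_carr[OF T] Cc[of x] C0
    by (simp add: op_kernel_def)
  moreover have "C x \<in> op_kernel H T" if "x \<in> op_kernel H (adjoint H T)" for x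
    using that TC[of "C x"] CC[of x] Cc[of x] C0 by (simp add: op_kernel_def)
  ultimately show ?thesis
    by (intro antisym hdim_le_conjugation[OF C]) (auto simp: op_kernel_def)
qed

end

section \<open>Conjugations for unitary operators\<close>

context complex_ip
begin

text \<open>An explicit adjoint in place of the chosen one. The relation is symmetric, and
  additivity and homogeneity of both maps follow from it.\<close>

definition adj_pair :: "('a \<Rightarrow> 'a) \<Rightarrow> ('a \<Rightarrow> 'a) \<Rightarrow> bool" where
  "adj_pair T S \<longleftrightarrow> (\<forall>x\<in>carr. T x \<in> carr \<and> S x \<in> carr) \<and>
     (\<forall>x\<in>carr. \<forall>y\<in>carr. \<langle>T x,y\<rangle> = \<langle>x,S y\<rangle>)"

lemma adj_pair_carr: "\<lbrakk>adj_pair T S; x \<in> carr\<rbrakk> \<Longrightarrow> T x \<in> carr"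
  and adj_pair_ip: "\<lbrakk>adj_pair T S; x \<in> carr; y \<in> carr\<rbrakk> \<Longrightarrow> \<langle>T x,y\<rangle> = \<langle>x,S y\<rangle>"
  by (auto simp: adj_pair_def)

lemma adj_pair_sym:
  assumes "adj_pair T S"
  shows "adj_pair S T"
  unfolding adj_pair_def
proof (intro conjI ballI)
  show "\<langle>S x,y\<rangle> = \<langle>x,T y\<rangle>" if "x \<in> carr" "y \<in> carr" for x y
    using that assms ip_commute[of "S x" y] ip_commute[of x "T y"] by (simp add: adj_pair_def)
qed (use assms in \<open>auto simp: adj_pair_def\<close>)

lemma adj_pair_add:
  assumes "adj_pair T S" "x \<in> carr" "y \<in> carr"
  shows "T (x \<oplus> y) = T x \<oplus> T y"
  by (rule ip_eqI) (use assms in \<open>simp_all add: adj_pair_def\<close>)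

lemma adj_pair_scale:
  assumes "adj_pair T S" "x \<in> carr"
  shows "T (a \<odot> x) = a \<odot> T x"
  by (rule ip_eqI) (use assms in \<open>simp_all add: adj_pair_def\<close>)

lemma adj_pair_diff:
  assumes "adj_pair T S" "x \<in> carr" "y \<in> carr"
  shows "T (x \<ominus> y) = T x \<ominus> T y"
  by (rule ip_eqI) (use assms in \<open>simp_all add: adj_pair_def\<close>)

lemma adj_pair_zero:
  assumes "adj_pair T S"
  shows "T zer = zer"
  by (rule ip_eqI) (use assms in \<open>simp_all add: adj_pair_def\<close>)

lemma adj_pair_funpow:
  assumes "adj_pair T S"
  shows "adj_pair (T ^^ k) (S ^^ k)"
proof (induction k)
  case 0
  show ?case by (simp add: adj_pair_def)
next
  case (Suc k)
  have "\<langle>(T ^^ Suc k) x,y\<rangle> = \<langle>x,(S ^^ Suc k) y\<rangle>" if "x \<in> carr" "y \<in> carr" for x y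
    using that Suc assms by (simp add: adj_pair_def funpow_swap1)
  then show ?case using Suc assms by (simp add: adj_pair_def)
qed

end

text \<open>Naming the inverse \<open>V\<close> lets negative powers of the unitary \<open>U\<close>
  be written as natural powers of \<open>V\<close>.\<close>

locale unitary_pair = complex_hilbert +
  fixes U V :: "'a \<Rightarrow> 'a"
  assumes UV_adj: "adj_pair U V"
    and UV_inv: "\<And>x. x \<in> carr \<Longrightarrow> U (V x) = x"
    and VU_inv: "\<And>x. x \<in> carr \<Longrightarrow> V (U x) = x"
begin

lemma VU_adj: "adj_pair V U"
  by (rule adj_pair_sym[OF UV_adj])

lemmas U_carr [simp] = adj_pair_carr[OF UV_adj]
lemmas V_carr [simp] = adj_pair_carr[OF VU_adj]
lemmas U_ip = adj_pair_ip[OF UV_adj]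
lemmas V_ip = adj_pair_ip[OF VU_adj]
lemmas Un_carr [simp] = adj_pair_carr[OF adj_pair_funpow[OF UV_adj]]
lemmas Vn_carr [simp] = adj_pair_carr[OF adj_pair_funpow[OF VU_adj]]
lemmas Un_ip = adj_pair_ip[OF adj_pair_funpow[OF UV_adj]]

text \<open>The graph of the conjugation \<open>U\<^sup>k w \<mapsto> U\<^sup>-\<^sup>k w\<close> on the linear span of the orbits of \<open>W\<close>.\<close>
inductive conj_graph :: "'a set \<Rightarrow> 'a \<Rightarrow> 'a \<Rightarrow> bool" for W where
  gen: "w \<in> W \<Longrightarrow> conj_graph W w w"
| U: "conj_graph W p q \<Longrightarrow> conj_graph W (U p) (V q)"
| V: "conj_graph W p q \<Longrightarrow> conj_graph W (V p) (U q)"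
| zero: "conj_graph W zer zer"
| add: "conj_graph W p q \<Longrightarrow> conj_graph W p' q' \<Longrightarrow> conj_graph W (p \<oplus> p') (q \<oplus> q')"
| scale: "conj_graph W p q \<Longrightarrow> conj_graph W (a \<odot> p) (cnj a \<odot> q)"

text \<open>This symmetry is what later makes the conjugation an involution.\<close>

lemma conj_graph_swap: "conj_graph W p q \<Longrightarrow> conj_graph W q p"
proof (induction rule: conj_graph.induct)
  case (scale p q a)
  then show ?case using conj_graph.scale[of W q p "cnj a"] by simp
qed (auto intro: conj_graph.intros)

lemma conj_graph_carr:
  assumes "W \<subseteq> carr" "conj_graph W p q"
  shows "p \<in> carr" "q \<in> carr"
  using assms(2,1) by (induction rule: conj_graph.induct) auto

lemma conj_graph_diff:
  assumes "conj_graph W p q" "conj_graph W p' q'"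
  shows "conj_graph W (p \<ominus> p') (q \<ominus> q')"
  using conj_graph.add[OF assms(1) conj_graph.scale[OF assms(2), of "-1"]]
  by (simp add: hs_diff_def)

text \<open>The pairs \<open>(U^k v, U^-k v)\<close> for integers k; the disjuncts are the two signs
  of k.\<close>

definition orbit :: "'a \<Rightarrow> 'a \<Rightarrow> 'a \<Rightarrow> bool" where
  "orbit v p q \<longleftrightarrow> (\<exists>k. p = (U ^^ k) v \<and> q = (V ^^ k) v \<or> p = (V ^^ k) v \<and> q = (U ^^ k) v)"

lemma orbit_carr: "\<lbrakk>v \<in> carr; orbit v p q\<rbrakk> \<Longrightarrow> p \<in> carr \<and> q \<in> carr"
  by (auto simp: orbit_def)

lemma orbit_swap: "orbit v p q \<Longrightarrow> orbit v q p"
  by (auto simp: orbit_def)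

lemma orbit_U:
  assumes v: "v \<in> carr" and "orbit v p q"
  shows "orbit v (U p) (V q)"
proof -
  from assms(2) obtain k
    where "p = (U ^^ k) v \<and> q = (V ^^ k) v \<or> p = (V ^^ k) v \<and> q = (U ^^ k) v"
    unfolding orbit_def by blast
  then show ?thesis
  proof
    assume "p = (U ^^ k) v \<and> q = (V ^^ k) v"
    then show ?thesis unfolding orbit_def by (intro exI[of _ "Suc k"]) simp
  next
    assume pq: "p = (V ^^ k) v \<and> q = (U ^^ k) v"
    show ?thesis
    proof (cases k)
      case 0
      then show ?thesis using pq unfolding orbit_def by (intro exI[of _ 1]) simp
    next
      case (Suc j)
      then show ?thesis
        using pq v UV_inv VU_inv unfolding orbit_def by (intro exI[of _ j]) simp
    qed
  qed
qed

lemma orbit_V: "\<lbrakk>v \<in> carr; orbit v p q\<rbrakk> \<Longrightarrow> orbit v (V p) (U q)"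
  by (rule orbit_swap[OF orbit_U[OF _ orbit_swap]])

text \<open>Distinct generators have orthogonal orbits, while nothing is asked of the orbit of a
  single one. Natural powers suffice: a negative power moves to the other argument, with the roles
  of \<open>v\<close> and \<open>w\<close> exchanged.\<close>

definition wandering :: "'a set \<Rightarrow> bool" where
  "wandering W \<longleftrightarrow> W \<subseteq> carr \<and> (\<forall>v\<in>W. \<forall>w\<in>W. v \<noteq> w \<longrightarrow> (\<forall>k. \<langle>(U ^^ k) v,w\<rangle> = 0))"

lemma wanderingD: "\<lbrakk>wandering W; v \<in> W; w \<in> W; v \<noteq> w\<rbrakk> \<Longrightarrow> \<langle>(U ^^ k) v,w\<rangle> = 0"
  by (simp add: wandering_def)

text \<open>After moving the powers of \<open>V\<close> across, the right-hand side becomes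
  \<langle>U^k w, v\<rangle>. For \<open>v = w\<close> this is the left-hand side, and for distinct
  generators both sides vanish.\<close>

lemma orbit_gen_ip:
  assumes W: "wandering W" and v: "v \<in> W" and w: "w \<in> W" and o: "orbit v p q"
  shows "\<langle>p,w\<rangle> = cnj \<langle>q,w\<rangle>"
proof -
  have vc: "v \<in> carr" and wc: "w \<in> carr" using W v w by (auto simp: wandering_def)
  have *: "\<langle>(U ^^ k) v,w\<rangle> = cnj \<langle>(V ^^ k) v,w\<rangle>" for k
  proof -
    have Vk: "cnj \<langle>(V ^^ k) v,w\<rangle> = \<langle>(U ^^ k) w,v\<rangle>"
      using ip_commute[of w "(V ^^ k) v"] Un_ip[OF wc vc] vc wc by simp
    show ?thesis
    proof (cases "v = w")
      case True
      then show ?thesis unfolding Vk by simp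
    next
      case False
      then have "\<langle>(U ^^ k) v,w\<rangle> = 0" "\<langle>(U ^^ k) w,v\<rangle> = 0"
        using wanderingD[OF W v w] wanderingD[OF W w v] by auto
      then show ?thesis unfolding Vk by simp
    qed
  qed
  from o obtain k
    where "p = (U ^^ k) v \<and> q = (V ^^ k) v \<or> p = (V ^^ k) v \<and> q = (U ^^ k) v"
    unfolding orbit_def by blast
  then show ?thesis using *[of k] by auto
qed

text \<open>Induction on the second pair. A \<open>U\<close> or \<open>V\<close> applied there moves
  to the first pair, which stays in the orbit of \<open>v\<close>; hence the orbit pair must be
  arbitrary in the induction.\<close>

lemma orbit_graph_ip:
  assumes W: "wandering W" and v: "v \<in> W" and "conj_graph W p' q'" "orbit v p q"
  shows "\<langle>p,p'\<rangle> = cnj \<langle>q,q'\<rangle>"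
proof -
  have Wc: "W \<subseteq> carr" and vc: "v \<in> carr" using W v by (auto simp: wandering_def)
  note gc = conj_graph_carr[OF Wc] and oc = orbit_carr[OF vc]
  show ?thesis using assms(3,4)
  proof (induction arbitrary: p q rule: conj_graph.induct)
    case (gen w)
    then show ?case using orbit_gen_ip[OF W v] by blast
  next
    case (U p' q')
    have "\<langle>V p,p'\<rangle> = cnj \<langle>U q,q'\<rangle>" using U.IH orbit_V[OF vc U.prems] .
    then show ?case
      using U_ip[of q q'] V_ip[of p p'] gc[OF U.hyps] oc[OF U.prems] by simp
  next
    case (V p' q')
    have "\<langle>U p,p'\<rangle> = cnj \<langle>V q,q'\<rangle>" using V.IH orbit_U[OF vc V.prems] .
    then show ?case
      using V_ip[of q q'] U_ip[of p p'] gc[OF V.hyps] oc[OF V.prems] by simp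
  next
    case zero
    then show ?case using oc by simp
  next
    case (add a b a' b')
    show ?case
      using add.IH(1)[OF add.prems] add.IH(2)[OF add.prems] gc[OF add.hyps(1)] gc[OF add.hyps(2)]
        oc[OF add.prems] by simp
  next
    case (scale p' q' a)
    show ?case using scale.IH[OF scale.prems] gc[OF scale.hyps] oc[OF scale.prems] by simp
  qed
qed

text \<open>The same transfer of \<open>U\<close> and \<open>V\<close>, now with both pairs in the
  linear span. Applied to a pair and itself it shows that norms are preserved, so by linearity the
  relation is the graph of a function.\<close>

lemma graph_ip:
  assumes W: "wandering W" and "conj_graph W p q" "conj_graph W p' q'"
  shows "\<langle>p,p'\<rangle> = cnj \<langle>q,q'\<rangle>"
proof -
  have Wc: "W \<subseteq> carr" using W by (auto simp: wandering_def)
  note gc = conj_graph_carr[OF Wc]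
  show ?thesis using assms(2,3)
  proof (induction arbitrary: p' q' rule: conj_graph.induct)
    case (gen w)
    have "orbit w w w" unfolding orbit_def by (intro exI[of _ 0]) simp
    then show ?case using orbit_graph_ip[OF W gen.hyps gen.prems] by blast
  next
    case (U p q)
    have "\<langle>p,V p'\<rangle> = cnj \<langle>q,U q'\<rangle>" using U.IH conj_graph.V[OF U.prems] .
    then show ?case
      using U_ip[of p p'] V_ip[of q q'] gc[OF U.hyps] gc[OF U.prems] by simp
  next
    case (V p q)
    have "\<langle>p,U p'\<rangle> = cnj \<langle>q,V q'\<rangle>" using V.IH conj_graph.U[OF V.prems] .
    then show ?case
      using V_ip[of p p'] U_ip[of q q'] gc[OF V.hyps] gc[OF V.prems] by simp
  next
    case zero
    then show ?case using gc by simp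
  next
    case (add a b a' b')
    show ?case
      using add.IH(1)[OF add.prems] add.IH(2)[OF add.prems] gc[OF add.hyps(1)] gc[OF add.hyps(2)]
        gc[OF add.prems] by simp
  next
    case (scale p q a)
    show ?case using scale.IH[OF scale.prems] gc[OF scale.hyps] gc[OF scale.prems] by simp
  qed
qed

section \<open>Total families of orthogonal cyclic subspaces\<close>

definition cyclic_span :: "'a set \<Rightarrow> 'a set" where
  "cyclic_span W = {p. \<exists>q. conj_graph W p q}"

lemma cyclic_spanI: "conj_graph W p q \<Longrightarrow> p \<in> cyclic_span W"
  by (auto simp: cyclic_span_def)

lemma subspace_cyclic_span:
  assumes "W \<subseteq> carr"
  shows "subspace (cyclic_span W)"
  unfolding subspace_def
proof (intro conjI ballI allI subsetI)
  show "zer \<in> cyclic_span W" by (rule cyclic_spanI[OF conj_graph.zero])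
  fix x assume "x \<in> cyclic_span W"
  then obtain p where p: "conj_graph W x p" by (auto simp: cyclic_span_def)
  show "x \<in> carr" using conj_graph_carr(1)[OF assms p] .
  show "a \<odot> x \<in> cyclic_span W" for a by (rule cyclic_spanI[OF conj_graph.scale[OF p]])
  fix y assume "y \<in> cyclic_span W"
  then obtain q where q: "conj_graph W y q" by (auto simp: cyclic_span_def)
  show "x \<oplus> y \<in> cyclic_span W" by (rule cyclic_spanI[OF conj_graph.add[OF p q]])
qed

lemma funpow_cyclic_span:
  assumes "w \<in> W"
  shows "(U ^^ k) w \<in> cyclic_span W" "(V ^^ k) w \<in> cyclic_span W"
proof -
  have "conj_graph W ((U ^^ k) w) ((V ^^ k) w)"
    by (induction k) (auto intro: conj_graph.intros assms)
  then show "(U ^^ k) w \<in> cyclic_span W" "(V ^^ k) w \<in> cyclic_span W"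
    using cyclic_spanI conj_graph_swap by metis+
qed

text \<open>The span contains all powers of \<open>U\<close> and \<open>V\<close> applied to old
  generators, so orthogonality of \<open>w\<close> to it controls the old orbits against
  \<open>w\<close> and, by adjointness, the orbit of \<open>w\<close> against the old
  generators.\<close>

lemma wandering_insert:
  assumes W: "wandering W" and w: "w \<in> carr" "\<And>m. m \<in> cyclic_span W \<Longrightarrow> \<langle>w,m\<rangle> = 0"
  shows "wandering (insert w W)"
proof -
  have Wc: "W \<subseteq> carr" using W by (auto simp: wandering_def)
  have 1: "\<langle>(U ^^ k) v,w\<rangle> = 0" if "v \<in> W" for v k
    using w(2)[OF funpow_cyclic_span(1)[OF that, of k]] ip_swap_eq_0[of w "(U ^^ k) v"] w(1) Wc that
    by auto
  have 2: "\<langle>(U ^^ k) w,v\<rangle> = 0" if "v \<in> W" for v k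
    using w(2)[OF funpow_cyclic_span(2)[OF that, of k]] Un_ip[of w v k] w(1) Wc that by auto
  show ?thesis
    unfolding wandering_def
  proof (intro conjI ballI impI allI)
    show "insert w W \<subseteq> carr" using Wc w(1) by simp
    show "\<langle>(U ^^ k) a,b\<rangle> = 0" if "a \<in> insert w W" "b \<in> insert w W" "a \<noteq> b" for a b k
      using that 1[of a k] 2[of b k] wanderingD[OF W, of a b k] by auto
  qed
qed

lemma exists_total_wandering:
  assumes e: "e \<in> carr"
  shows "\<exists>W. wandering W \<and> e \<in> W \<and> (\<forall>w\<in>carr. (\<forall>m\<in>cyclic_span W. \<langle>w,m\<rangle> = 0) \<longrightarrow> w = zer)"
proof -
  let ?A = "{W. wandering W \<and> e \<in> W}"
  have "\<exists>M\<in>?A. \<forall>X\<in>?A. M \<subseteq> X \<longrightarrow> X = M"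
  proof (rule subset_Zorn_nonempty)
    \<comment> \<open>The generator \<open>e\<close> may be \<open>zer\<close>; trivial kernels rely
      on this.\<close>
    have "{e} \<in> ?A" using e by (auto simp: wandering_def)
    then show "?A \<noteq> {}" by blast
    fix Ch assume ne: "Ch \<noteq> {}" and ch: "subset.chain ?A Ch"
    have sub: "\<And>W. W \<in> Ch \<Longrightarrow> wandering W \<and> e \<in> W"
      and lin: "\<And>X Y. \<lbrakk>X \<in> Ch; Y \<in> Ch\<rbrakk> \<Longrightarrow> X \<subseteq> Y \<or> Y \<subseteq> X"
      using ch unfolding subset_chain_def by blast+
    have "wandering (\<Union>Ch)"
      unfolding wandering_def
    proof (intro conjI ballI impI allI)
      show "\<Union>Ch \<subseteq> carr" using sub unfolding wandering_def by blast
      fix a b k assume ab: "a \<in> \<Union>Ch" "b \<in> \<Union>Ch" "a \<noteq> b"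
      then obtain X where "X \<in> Ch" "a \<in> X" "b \<in> X" using lin by blast
      then show "\<langle>(U ^^ k) a,b\<rangle> = 0" using sub[of X] ab(3) wanderingD[of X a b k] by simp
    qed
    then show "\<Union>Ch \<in> ?A" using ne sub by blast
  qed
  then obtain W where W: "wandering W" "e \<in> W"
    and maxi: "\<And>X. \<lbrakk>wandering X; e \<in> X; W \<subseteq> X\<rbrakk> \<Longrightarrow> X = W" by blast
  have "w = zer" if w: "w \<in> carr" "\<forall>m\<in>cyclic_span W. \<langle>w,m\<rangle> = 0" for w
  proof -
    \<comment> \<open>Maximality puts \<open>w\<close> into \<open>W\<close>, hence into the span it
      is orthogonal to, so \<open>w\<close> is orthogonal to itself.\<close>
    have "insert w W = W" using wandering_insert[OF W(1)] w W(2) by (intro maxi) auto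
    then have "w \<in> cyclic_span W" using funpow_cyclic_span(1)[of w W 0] by auto
    then show ?thesis using w ip_self_zeroD by blast
  qed
  then show ?thesis using W by blast
qed

text \<open>Totality makes the span dense, so \<open>x\<close> is a limit of vectors
  \<open>X n\<close> with partners \<open>Y n\<close>. The relation is isometric on differences, so
  the partners converge too, and their limit is the value at \<open>x\<close>.\<close>

lemma graph_extend:
  assumes W: "wandering W"
    and total: "\<And>w. \<lbrakk>w \<in> carr; \<forall>m\<in>cyclic_span W. \<langle>w,m\<rangle> = 0\<rbrakk> \<Longrightarrow> w = zer"
    and x: "x \<in> carr"
  shows "\<exists>y\<in>carr. (\<forall>p q. conj_graph W p q \<longrightarrow> \<langle>y,q\<rangle> = cnj \<langle>x,p\<rangle>) \<and> \<langle>y,y\<rangle> = \<langle>x,x\<rangle>"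
proof -
  have Wc: "W \<subseteq> carr" using W by (auto simp: wandering_def)
  note gc = conj_graph_carr[OF Wc]
  obtain X p where XM: "\<And>n. X n \<in> cyclic_span W" and X: "Cauchy_H X" "p \<in> carr" "tends X p"
    and orth: "\<forall>m\<in>cyclic_span W. \<langle>x \<ominus> p,m\<rangle> = 0"
    using approximate_projection[OF subspace_cyclic_span[OF Wc] x] by blast
  \<comment> \<open>The residual x - p is orthogonal to the span and therefore vanishes by
    totality.\<close>
  have px: "p = x"
    using total[OF _ orth] diff_eq_zeroD[OF x X(2)] x X(2) by simp
  have "\<forall>n. \<exists>q. conj_graph W (X n) q" using XM unfolding cyclic_span_def by blast
  then obtain Y where XY: "\<And>n. conj_graph W (X n) (Y n)" by metis
  have c: "X n \<in> carr" "Y n \<in> carr" for n using gc XY by blast+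
  have "nrm (Y m \<ominus> Y n) = nrm (X m \<ominus> X n)" for m n
  proof -
    have g: "conj_graph W (Y m \<ominus> Y n) (X m \<ominus> X n)"
      by (rule conj_graph_swap[OF conj_graph_diff[OF XY XY]])
    then show ?thesis using graph_ip[OF W g g] unfolding hs_norm_def by simp
  qed
  then have "Cauchy_H Y" using X(1) unfolding Cauchy_H_def by simp
  then obtain y where y: "y \<in> carr" "tends Y y" using complete[of Y, OF c(2)] by blast
  have "\<langle>y,q\<rangle> = cnj \<langle>x,p'\<rangle>" if g: "conj_graph W p' q" for p' q
  proof (rule LIMSEQ_unique)
    show "(\<lambda>n. \<langle>Y n,q\<rangle>) \<longlonglongrightarrow> \<langle>y,q\<rangle>"
      using c y gc[OF g] by (intro tends_ip_left)
    have "(\<lambda>n. cnj \<langle>X n,p'\<rangle>) \<longlonglongrightarrow> cnj \<langle>x,p'\<rangle>"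
      using c X gc[OF g] x unfolding px by (intro tendsto_cnj tends_ip_left)
    then show "(\<lambda>n. \<langle>Y n,q\<rangle>) \<longlonglongrightarrow> cnj \<langle>x,p'\<rangle>"
      using graph_ip[OF W conj_graph_swap[OF XY] conj_graph_swap[OF g]] by simp
  qed
  moreover have "\<langle>y,y\<rangle> = \<langle>x,x\<rangle>"
  proof (rule LIMSEQ_unique)
    show "(\<lambda>n. \<langle>Y n,Y n\<rangle>) \<longlonglongrightarrow> \<langle>y,y\<rangle>" using c y by (intro tends_ip_self)
    have "\<langle>Y n,Y n\<rangle> = \<langle>X n,X n\<rangle>" for n
      using graph_ip[OF W XY[of n] XY[of n]] ip_commute[OF c(2) c(2), of n n] by simp
    then show "(\<lambda>n. \<langle>Y n,Y n\<rangle>) \<longlonglongrightarrow> \<langle>x,x\<rangle>"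
      using tends_ip_self[of X, OF c(1) X(2,3)] unfolding px by simp
  qed
  ultimately show ?thesis using y(1) by blast
qed

lemma unitary_conjugation:
  assumes e: "e \<in> carr"
  shows "\<exists>C. conjugation H C \<and> (\<forall>x\<in>carr. C (U x) = V (C x)) \<and> C e = e"
proof -
  obtain W where W: "wandering W" "e \<in> W"
    and total: "\<And>w. \<lbrakk>w \<in> carr; \<forall>m\<in>cyclic_span W. \<langle>w,m\<rangle> = 0\<rbrakk> \<Longrightarrow> w = zer"
    using exists_total_wandering[OF e] by blast
  have Wc: "W \<subseteq> carr" using W by (auto simp: wandering_def)
  note gc = conj_graph_carr[OF Wc]
  \<comment> \<open>Vectors are determined by their inner products with the span. The algebraic laws
    of \<open>C\<close> are all checked this way, while isometry comes directly from the limit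
    construction.\<close>
  have uniq: "y = z" if yz: "y \<in> carr" "z \<in> carr" and eq: "\<And>p q. conj_graph W p q \<Longrightarrow> \<langle>y,q\<rangle> = \<langle>z,q\<rangle>"
    for y z
  proof (rule diff_eq_zeroD[OF yz], rule total)
    show "\<forall>m\<in>cyclic_span W. \<langle>y \<ominus> z,m\<rangle> = 0"
    proof
      fix m assume "m \<in> cyclic_span W"
      then obtain q where g: "conj_graph W m q" unfolding cyclic_span_def by blast
      show "\<langle>y \<ominus> z,m\<rangle> = 0" using eq[OF conj_graph_swap[OF g]] gc[OF g] yz by simp
    qed
  qed (use yz in simp)
  have "\<forall>x. \<exists>y. x \<in> carr \<longrightarrow>
    y \<in> carr \<and> (\<forall>p q. conj_graph W p q \<longrightarrow> \<langle>y,q\<rangle> = cnj \<langle>x,p\<rangle>) \<and> \<langle>y,y\<rangle> = \<langle>x,x\<rangle>"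
    using graph_extend[OF W(1) total] by blast
  then obtain C where C: "\<forall>x. x \<in> carr \<longrightarrow>
    C x \<in> carr \<and> (\<forall>p q. conj_graph W p q \<longrightarrow> \<langle>C x,q\<rangle> = cnj \<langle>x,p\<rangle>) \<and> \<langle>C x,C x\<rangle> = \<langle>x,x\<rangle>"
    by (rule choice[THEN exE])
  have Cc: "C x \<in> carr" and Ciso: "\<langle>C x,C x\<rangle> = \<langle>x,x\<rangle>" if "x \<in> carr" for x
    using C that by auto
  have Cip: "\<langle>C x,q\<rangle> = cnj \<langle>x,p\<rangle>" if "x \<in> carr" "conj_graph W p q" for x p q
    using C that by blast
  have "conjugation H C"
    unfolding conjugation_def
  proof (intro conjI ballI allI)
    fix x assume x: "x \<in> carr"
    show "C x \<in> carr" using Cc x .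
    show "nrm (C x) = nrm x" unfolding hs_norm_def using Ciso[OF x] by simp
    show "C (C x) = x"
    proof (rule uniq)
      fix p q assume g: "conj_graph W p q"
      show "\<langle>C (C x),q\<rangle> = \<langle>x,q\<rangle>"
        using Cip[OF Cc[OF x] g] Cip[OF x conj_graph_swap[OF g]] by simp
    qed (use x Cc in auto)
    show "C (a \<odot> x) = cnj a \<odot> C x" for a
    proof (rule uniq)
      fix p q assume g: "conj_graph W p q"
      show "\<langle>C (a \<odot> x),q\<rangle> = \<langle>cnj a \<odot> C x,q\<rangle>"
        using Cip[OF x g] Cip[OF scale_carr[OF x] g] gc[OF g] Cc[OF x] x by simp
    qed (use x Cc in auto)
    show "C (x \<oplus> y) = C x \<oplus> C y" if y: "y \<in> carr" for y
    proof (rule uniq)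
      fix p q assume g: "conj_graph W p q"
      show "\<langle>C (x \<oplus> y),q\<rangle> = \<langle>C x \<oplus> C y,q\<rangle>"
        using Cip[OF x g] Cip[OF y g] Cip[OF add_carr[OF x y] g] gc[OF g] Cc[OF x] Cc[OF y] x y by simp
    qed (use x y Cc in auto)
  qed
  moreover have "C (U x) = V (C x)" if x: "x \<in> carr" for x
  proof (rule uniq)
    fix p q assume g: "conj_graph W p q"
    have "\<langle>V (C x),q\<rangle> = \<langle>C x,U q\<rangle>" using V_ip[OF Cc[OF x] gc(2)[OF g]] .
    also have "\<dots> = cnj \<langle>x,V p\<rangle>" using Cip[OF x conj_graph.V[OF g]] .
    also have "\<dots> = cnj \<langle>U x,p\<rangle>" using U_ip[OF x gc(1)[OF g]] by simp
    finally show "\<langle>C (U x),q\<rangle> = \<langle>V (C x),q\<rangle>" using Cip[OF U_carr[OF x] g] by simp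
  qed (use x Cc in auto)
  moreover have "C e = e"
  proof (rule uniq)
    fix p q assume g: "conj_graph W p q"
    have "\<langle>e,q\<rangle> = cnj \<langle>e,p\<rangle>"
      using graph_ip[OF W(1) conj_graph.gen[OF W(2)] conj_graph_swap[OF g]] .
    then show "\<langle>C e,q\<rangle> = \<langle>e,q\<rangle>" using Cip[OF e g] by simp
  qed (use e Cc in auto)
  ultimately show ?thesis by blast
qed

end

section \<open>Partial isometries with small kernels\<close>

context complex_ip
begin

lemma hdim_ge: "\<lbrakk>finite B; B \<subseteq> S; orthonormal H B\<rbrakk> \<Longrightarrow> enat (card B) \<le> hdim H S"
  unfolding hdim_def by (intro Sup_upper) auto

lemma hdim_le:
  assumes "\<And>B. \<lbrakk>finite B; B \<subseteq> S; orthonormal H B\<rbrakk> \<Longrightarrow> enat (card B) \<le> n"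
  shows "hdim H S \<le> n"
  unfolding hdim_def using assms by (intro Sup_least) auto

lemma normalize:
  assumes S: "subspace S" and x: "x \<in> S" "x \<noteq> zer"
  shows "\<exists>c. c \<noteq> 0 \<and> c \<odot> x \<in> S \<and> \<langle>c \<odot> x,c \<odot> x\<rangle> = 1"
proof -
  have xc: "x \<in> carr" using S x by (auto simp: subspace_def)
  define c where "c = complex_of_real (1 / nrm x)"
  have n: "nrm x \<noteq> 0"
    using ip_self_eq[OF xc] ip_self_zeroD[OF xc] x(2) by auto
  have "\<langle>c \<odot> x,c \<odot> x\<rangle> = c * (cnj c * of_real ((nrm x)\<^sup>2))"
    using xc ip_self_eq[OF xc] by simp
  also have "\<dots> = 1" using n by (simp add: c_def power2_eq_square)
  finally have "\<langle>c \<odot> x,c \<odot> x\<rangle> = 1" .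
  moreover have "c \<noteq> 0" using n by (simp add: c_def)
  moreover have "c \<odot> x \<in> S" using S x by (simp add: subspace_def)
  ultimately show ?thesis by (intro exI[of _ c]) simp
qed

text \<open>Dimension zero gets the generator \<open>zer\<close>, dimension one a unit vector. Equal
  dimensions of two kernels thus give generators of equal norm, and both cases can be treated
  together.\<close>

lemma hdim_le_1_generator:
  assumes S: "subspace S" and dim: "hdim H S \<le> 1"
  shows "\<exists>e\<in>S. \<langle>e,e\<rangle> = (if hdim H S = 0 then 0 else 1) \<and> (\<forall>x\<in>S. \<exists>c. x = c \<odot> e)"
proof (cases "S = {zer}")
  case True
  have "hdim H S \<le> 0"
  proof (rule hdim_le)
    fix B assume B: "finite B" "B \<subseteq> S" "orthonormal H B"
    have "zer \<notin> B" using B(3) by (auto simp: orthonormal_def)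
    then have "B = {}" using B(2) True by auto
    then show "enat (card B) \<le> 0" by (simp add: zero_enat_def)
  qed
  then have "hdim H S = 0" by simp
  then show ?thesis using True scale_zero_left[of zer] by (auto intro: exI[of _ 0])
next
  case False
  have Sc: "x \<in> carr" if "x \<in> S" for x using S that by (auto simp: subspace_def)
  obtain x where x: "x \<in> S" "x \<noteq> zer" using False S by (auto simp: subspace_def)
  obtain c where c: "c \<odot> x \<in> S" "\<langle>c \<odot> x,c \<odot> x\<rangle> = 1" using normalize[OF S x] by auto
  define e where "e = c \<odot> x"
  have e: "e \<in> S" "\<langle>e,e\<rangle> = 1" "e \<in> carr" using c Sc[OF c(1)] by (simp_all add: e_def)
  have "enat (card {e}) \<le> hdim H S"
    using e by (intro hdim_ge) (auto simp: orthonormal_def)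
  then have "hdim H S \<noteq> 0" by (auto simp: zero_enat_def)
  \<comment> \<open>A vector off the line through \<open>e\<close> would yield, after projection and
    normalisation, an orthonormal pair in \<open>S\<close>.\<close>
  moreover have "y = \<langle>y,e\<rangle> \<odot> e" if y: "y \<in> S" for y
  proof (rule ccontr)
    assume neq: "y \<noteq> \<langle>y,e\<rangle> \<odot> e"
    define z where "z = y \<ominus> \<langle>y,e\<rangle> \<odot> e"
    have yc: "y \<in> carr" using Sc y .
    have zS: "z \<in> S" unfolding z_def using S y e(1) by (intro subspace_diff) (auto simp: subspace_def)
    have z0: "z \<noteq> zer" using neq diff_eq_zeroD[OF yc scale_carr[OF e(3)]] unfolding z_def by blast
    have ze: "\<langle>z,e\<rangle> = 0" using e yc by (simp add: z_def)
    obtain d where d: "d \<odot> z \<in> S" "\<langle>d \<odot> z,d \<odot> z\<rangle> = 1" using normalize[OF S zS z0] by auto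
    define u where "u = d \<odot> z"
    have u: "u \<in> S" "u \<in> carr" "\<langle>u,u\<rangle> = 1" using d Sc[OF d(1)] by (simp_all add: u_def)
    have ue: "\<langle>u,e\<rangle> = 0" using ze e Sc[OF zS] by (simp add: u_def)
    have eu: "\<langle>e,u\<rangle> = 0" using ip_swap_eq_0[OF u(2) e(3) ue] .
    have ne: "u \<noteq> e" using ue e(2) by auto
    have "orthonormal H {u, e}" using u e ue eu by (simp add: orthonormal_def)
    then have "enat (card {u, e}) \<le> hdim H S" using u e by (intro hdim_ge) auto
    then have "enat (card {u, e}) \<le> 1" using dim by (rule order_trans)
    then show False using ne by (simp add: one_enat_def)
  qed
  ultimately show ?thesis using e by auto
qed

text \<open>The identity \<open>TST = T\<close> characterises partial isometries. A kernel of dimension at most one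
  is described by a generator \<open>e\<close> with \<open>\<langle>e,e\<rangle> \<in> {0, 1}\<close>, so that dimension zero is the case \<open>e = 0\<close>.\<close>
lemma partial_isometry_decomp:
  assumes TS: "adj_pair T S" and TST: "\<And>x. x \<in> carr \<Longrightarrow> T (S (T x)) = T x"
    and e: "e \<in> carr" "T e = zer" "\<langle>e,e\<rangle> = 0 \<or> \<langle>e,e\<rangle> = 1"
    and ker: "\<And>x. \<lbrakk>x \<in> carr; T x = zer\<rbrakk> \<Longrightarrow> \<exists>c. x = c \<odot> e"
    and x: "x \<in> carr"
  shows "x = S (T x) \<oplus> \<langle>x,e\<rangle> \<odot> e"
proof -
  note Tc = adj_pair_carr[OF TS] and Sc = adj_pair_carr[OF adj_pair_sym[OF TS]]
  have STx: "S (T x) \<in> carr" using Sc[OF Tc[OF x]] .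
  have "T (x \<ominus> S (T x)) = T x \<ominus> T x"
    using adj_pair_diff[OF TS x STx] TST[OF x] by simp
  also have "\<dots> = zer" using Tc[OF x] by (intro ip_self_zeroD) simp_all
  finally obtain c where c: "x \<ominus> S (T x) = c \<odot> e"
    using ker[OF diff_carr[OF x STx]] by blast
  have "\<langle>S (T x),e\<rangle> = \<langle>T x,T e\<rangle>" using adj_pair_ip[OF adj_pair_sym[OF TS] Tc[OF x] e(1)] .
  also have "\<dots> = 0" using e(2) Tc[OF x] by simp
  finally have xe: "\<langle>x,e\<rangle> = c * \<langle>e,e\<rangle>"
    using arg_cong[OF c, of "\<lambda>z. \<langle>z,e\<rangle>"] x STx e(1) by simp
  \<comment> \<open>For \<open>e = zer\<close> as for a unit vector, \<langle>e,e\<rangle> acts as 1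
    on inner products with \<open>e\<close>, which replaces a division by it.\<close>
  have ew: "\<langle>e,e\<rangle> * \<langle>e,w\<rangle> = \<langle>e,w\<rangle>" if "w \<in> carr" for w
    using e(3) ip_self_zeroD[OF e(1)] that by auto
  show ?thesis
  proof (rule ip_eqI)
    fix w assume w: "w \<in> carr"
    have "\<langle>x,w\<rangle> - \<langle>S (T x),w\<rangle> = c * \<langle>e,w\<rangle>"
      using arg_cong[OF c, of "\<lambda>z. \<langle>z,w\<rangle>"] x STx e(1) w by simp
    also have "\<dots> = c * (\<langle>e,e\<rangle> * \<langle>e,w\<rangle>)" by (simp only: ew[OF w])
    also have "\<dots> = \<langle>x,e\<rangle> * \<langle>e,w\<rangle>" by (simp add: xe)
    finally show "\<langle>x,w\<rangle> = \<langle>S (T x) \<oplus> \<langle>x,e\<rangle> \<odot> e,w\<rangle>"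
      using x STx e(1) w by (simp add: algebra_simps)
  qed (use x STx e(1) in simp_all)
qed

end

context complex_hilbert
begin

lemma bounded_op_adj_pair: "bounded_op H T \<Longrightarrow> adj_pair T (adjoint H T)"
  unfolding adj_pair_def using adjoint_carr ip_adjoint by (auto simp: bounded_op_def)

text \<open>Put \<open>d = x \<ominus> S (T x)\<close>. Idempotence of \<open>S T\<close> gives
  \<open>S (T d) = zer\<close>, so \<langle>T d, T d\<rangle> = \<langle>d, S (T d)\<rangle> =
  0.\<close>

lemma partial_isometry_TST:
  assumes pi: "partial_isometry H T" and x: "x \<in> carr"
  shows "T (adjoint H T (T x)) = T x"
proof -
  define S where "S = adjoint H T"
  have TS: "adj_pair T S"
    using pi bounded_op_adj_pair unfolding S_def partial_isometry_def by blast
  have idem: "S (T (S (T x))) = S (T x)"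
    using pi x unfolding partial_isometry_def orth_projection_def S_def by auto
  note Tc = adj_pair_carr[OF TS] and Sc = adj_pair_carr[OF adj_pair_sym[OF TS]]
  define d where "d = x \<ominus> S (T x)"
  have d: "d \<in> carr" unfolding d_def using x Tc Sc by simp
  have "S (T d) = S (T x) \<ominus> S (T (S (T x)))"
    unfolding d_def using x Tc Sc adj_pair_diff[OF TS] adj_pair_diff[OF adj_pair_sym[OF TS]] by simp
  then have "\<langle>d,S (T d)\<rangle> = 0" unfolding idem using d x Tc Sc by simp
  then have "\<langle>T d,T d\<rangle> = 0" using adj_pair_ip[OF TS d Tc[OF d]] by simp
  then have "T d = zer" using ip_self_zeroD[OF Tc[OF d]] by blast
  then have "T x \<ominus> T (S (T x)) = zer"
    unfolding d_def using adj_pair_diff[OF TS x Sc[OF Tc[OF x]]] by simp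
  then show ?thesis
    using diff_eq_zeroD[OF Tc[OF x] Tc[OF Sc[OF Tc[OF x]]]] unfolding S_def by simp
qed

lemma subspace_kernel: "adj_pair T S \<Longrightarrow> subspace (op_kernel H T)"
proof -
  assume TS: "adj_pair T S"
  have "zer \<oplus> zer = zer" "a \<odot> zer = zer" for a
    by (rule ip_self_zeroD; simp)+
  then show ?thesis
    using adj_pair_zero[OF TS] adj_pair_add[OF TS] adj_pair_scale[OF TS]
    by (auto simp: subspace_def op_kernel_def)
qed

text \<open>The rank-one term \<open>f \<otimes> e\<close> repairs exactly the defect of
  \<open>T\<close>: the initial space is the complement of \<open>e\<close>, the final space that of
  \<open>f\<close>. Removing the term again after conjugating uses \<open>C e = e\<close>.\<close>

lemma partial_isometry_complex_symmetric:
  assumes pi: "partial_isometry H T"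
    and e: "e \<in> carr" "T e = zer" and f: "f \<in> carr" "adjoint H T f = zer"
    and ef: "\<langle>e,e\<rangle> = \<langle>f,f\<rangle>" "\<langle>e,e\<rangle> = 0 \<or> \<langle>e,e\<rangle> = 1"
    and kerT: "\<And>x. \<lbrakk>x \<in> carr; T x = zer\<rbrakk> \<Longrightarrow> \<exists>c. x = c \<odot> e"
    and kerS: "\<And>x. \<lbrakk>x \<in> carr; adjoint H T x = zer\<rbrakk> \<Longrightarrow> \<exists>c. x = c \<odot> f"
  shows "complex_symmetric H T"
proof -
  define S where "S = adjoint H T"
  have TS: "adj_pair T S"
    using pi bounded_op_adj_pair unfolding S_def partial_isometry_def by blast
  note ST = adj_pair_sym[OF TS]
  note Tc = adj_pair_carr[OF TS] and Sc = adj_pair_carr[OF ST]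
  have Sf: "S f = zer" using f by (simp add: S_def)
  have TST: "T (S (T x)) = T x" if "x \<in> carr" for x
    using partial_isometry_TST[OF pi that] by (simp add: S_def)
  have STS: "S (T (S x)) = S x" if x: "x \<in> carr" for x
  proof (rule ip_eqI)
    fix w assume w: "w \<in> carr"
    have "\<langle>S (T (S x)),w\<rangle> = \<langle>x,T (S (T w))\<rangle>"
      using adj_pair_ip[OF ST Tc[OF Sc[OF x]] w] adj_pair_ip[OF TS Sc[OF x] Tc[OF w]]
        adj_pair_ip[OF ST x Sc[OF Tc[OF w]]] by simp
    also have "\<dots> = \<langle>S x,w\<rangle>" using TST[OF w] adj_pair_ip[OF ST x w] by simp
    finally show "\<langle>S (T (S x)),w\<rangle> = \<langle>S x,w\<rangle>" .
  qed (use x Tc Sc in simp_all)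
  have decT: "x = S (T x) \<oplus> \<langle>x,e\<rangle> \<odot> e" if "x \<in> carr" for x
    using partial_isometry_decomp[OF TS TST e ef(2) kerT that] by blast
  have decS: "x = T (S x) \<oplus> \<langle>x,f\<rangle> \<odot> f" if "x \<in> carr" for x
    using partial_isometry_decomp[OF ST STS f(1) Sf ef(2)[unfolded ef(1)] kerS[folded S_def] that] by blast
  have e_unit: "\<langle>x,e\<rangle> * \<langle>e,e\<rangle> = \<langle>x,e\<rangle>" if "x \<in> carr" for x
    using ef(2) ip_self_zeroD[OF e(1)] that by auto
  have f_unit: "\<langle>x,f\<rangle> * \<langle>f,f\<rangle> = \<langle>x,f\<rangle>" if "x \<in> carr" for x
    using ef ip_self_zeroD[OF f(1)] that by auto
  have Tf: "\<langle>T x,f\<rangle> = 0" if "x \<in> carr" for x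
    using adj_pair_ip[OF TS that f(1)] Sf that by simp
  have Se: "\<langle>S x,e\<rangle> = 0" if "x \<in> carr" for x
    using adj_pair_ip[OF ST that e(1)] e(2) that by simp
  define U where "U x = T x \<oplus> \<langle>x,e\<rangle> \<odot> f" for x
  define V where "V x = S x \<oplus> \<langle>x,f\<rangle> \<odot> e" for x
  have add_zer: "x \<oplus> zer = x" "zer \<oplus> x = x" if "x \<in> carr" for x
    by (rule ip_eqI; use that in simp)+
  have scale_zer: "a \<odot> zer = zer" for a by (rule ip_eqI) simp_all
  have SU: "S (U x) = S (T x)" if x: "x \<in> carr" for x
    unfolding U_def using adj_pair_add[OF ST Tc[OF x] scale_carr[OF f(1)]]
      adj_pair_scale[OF ST f(1)] Sf scale_zer add_zer[OF Sc[OF Tc[OF x]]] by simp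
  have TV: "T (V x) = T (S x)" if x: "x \<in> carr" for x
    unfolding V_def using adj_pair_add[OF TS Sc[OF x] scale_carr[OF e(1)]]
      adj_pair_scale[OF TS e(1)] e(2) scale_zer add_zer[OF Tc[OF Sc[OF x]]] by simp
  have Ue: "\<langle>U x,f\<rangle> = \<langle>x,e\<rangle>" if x: "x \<in> carr" for x
    unfolding U_def using Tf[OF x] e_unit[OF x] f(1) Tc[OF x] ef(1) by simp
  have Vf: "\<langle>V x,e\<rangle> = \<langle>x,f\<rangle>" if x: "x \<in> carr" for x
    unfolding V_def using Se[OF x] f_unit[OF x] e(1) Sc[OF x] ef(1) by simp
  interpret UV: unitary_pair H U V
  proof
    show "adj_pair U V"
      unfolding adj_pair_def
    proof (intro conjI ballI)
      show "U x \<in> carr" "V x \<in> carr" if "x \<in> carr" for x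
        using that Tc Sc e(1) f(1) by (simp_all add: U_def V_def)
      show "\<langle>U x,y\<rangle> = \<langle>x,V y\<rangle>" if x: "x \<in> carr" and y: "y \<in> carr" for x y
      proof -
        have "\<langle>U x,y\<rangle> = \<langle>T x,y\<rangle> + \<langle>x,e\<rangle> * \<langle>f,y\<rangle>"
          unfolding U_def using x y f(1) Tc[OF x] by simp
        moreover have "\<langle>x,V y\<rangle> = \<langle>x,S y\<rangle> + cnj \<langle>y,f\<rangle> * \<langle>x,e\<rangle>"
          unfolding V_def using x y e(1) Sc[OF y] by simp
        ultimately show ?thesis
          using adj_pair_ip[OF TS x y] ip_commute[OF f(1) y] by simp
      qed
    qed
    show "U (V x) = x" if x: "x \<in> carr" for x
      using decS[OF x] TV[OF x] Vf[OF x] unfolding U_def[of "V x"] by simp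
    show "V (U x) = x" if x: "x \<in> carr" for x
      using decT[OF x] SU[OF x] Ue[OF x] unfolding V_def[of "U x"] by simp
  qed
  obtain C where C: "conjugation H C" and CU: "\<And>x. x \<in> carr \<Longrightarrow> C (U x) = V (C x)" and Ce: "C e = e"
    using UV.unitary_conjugation[OF e(1)] by blast
  note Cc = conjugation_carr[OF C] and CC = conjugation_invol[OF C]
  define J where "J x = U (C x)" for x
  have J: "conjugation H J"
    unfolding conjugation_def
  proof (intro conjI ballI allI)
    fix x assume x: "x \<in> carr"
    show "J x \<in> carr" unfolding J_def using Cc[OF x] by (rule UV.U_carr)
    show "J (x \<oplus> y) = J x \<oplus> J y" if y: "y \<in> carr" for y
      unfolding J_def conjugation_add[OF C x y] by (rule adj_pair_add[OF UV.UV_adj Cc[OF x] Cc[OF y]])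
    show "J (a \<odot> x) = cnj a \<odot> J x" for a
      unfolding J_def conjugation_scale[OF C x] by (rule adj_pair_scale[OF UV.UV_adj Cc[OF x]])
    have "\<langle>J x,J x\<rangle> = \<langle>C x,C x\<rangle>"
      unfolding J_def using UV.U_ip[OF Cc[OF x] UV.U_carr[OF Cc[OF x]]] UV.VU_inv[OF Cc[OF x]] by simp
    then show "nrm (J x) = nrm x"
      using conjugation_nrm[OF C x] unfolding hs_norm_def by simp
    \<comment> \<open>\<open>U C U C = U V C C\<close>, which is the identity.\<close>
    show "J (J x) = x"
      unfolding J_def CU[OF Cc[OF x]] CC[OF x] by (rule UV.UV_inv[OF x])
  qed
  have "T x = J (S (J x))" if x: "x \<in> carr" for x
  proof -
    let ?z = "C x"
    have z: "?z \<in> carr" using Cc x .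
    have STz: "S (T ?z) \<in> carr" using Sc[OF Tc[OF z]] .
    have ze: "cnj \<langle>?z,e\<rangle> = \<langle>x,e\<rangle>"
      using conjugation_ip[OF C x e(1)] Ce by simp
    \<comment> \<open>Decompose \<open>C x\<close> along \<open>e\<close> and apply
      \<open>C\<close>, which fixes \<open>e\<close>. Applying \<open>U\<close> then turns the first
      summand into \<open>J (S (J x))\<close>, because \<open>S U = S T\<close>.\<close>
    have "x = C (S (T ?z) \<oplus> \<langle>?z,e\<rangle> \<odot> e)"
      using decT[OF z] CC[OF x] by simp
    also have "\<dots> = C (S (T ?z)) \<oplus> \<langle>x,e\<rangle> \<odot> e"
      using conjugation_add[OF C STz scale_carr[OF e(1)]] conjugation_scale[OF C e(1)] ze Ce by simp
    finally have "U x = U (C (S (T ?z)) \<oplus> \<langle>x,e\<rangle> \<odot> e)" by simp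
    also have "\<dots> = J (S (J x)) \<oplus> \<langle>x,e\<rangle> \<odot> U e"
      unfolding J_def SU[OF z]
      using adj_pair_add[OF UV.UV_adj Cc[OF STz] scale_carr[OF e(1)]]
        adj_pair_scale[OF UV.UV_adj e(1)] by simp
    finally have eq: "T x \<oplus> \<langle>x,e\<rangle> \<odot> f = J (S (J x)) \<oplus> \<langle>x,e\<rangle> \<odot> U e"
      unfolding U_def[of x] .
    have Uef: "U e = \<langle>e,e\<rangle> \<odot> f"
      unfolding U_def e(2) using f(1) by (intro add_zer(2)) simp
    have Jc: "J (S (J x)) \<in> carr"
      using conjugation_carr[OF J] Sc x by blast
    show ?thesis
    proof (rule ip_eqI)
      fix w assume w: "w \<in> carr"
      have "\<langle>T x,w\<rangle> + \<langle>x,e\<rangle> * \<langle>f,w\<rangle> = \<langle>J (S (J x)),w\<rangle> + (\<langle>x,e\<rangle> * \<langle>e,e\<rangle>) * \<langle>f,w\<rangle>"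
        using arg_cong[OF eq, of "\<lambda>z. \<langle>z,w\<rangle>"] Tc[OF x] f(1) w Jc unfolding Uef by simp
      then show "\<langle>T x,w\<rangle> = \<langle>J (S (J x)),w\<rangle>"
        unfolding e_unit[OF x] by simp
    qed (use Tc[OF x] Jc in simp_all)
  qed
  then show ?thesis
    unfolding complex_symmetric_def S_def using J by blast
qed

lemma partial_isometry_small_kernel:
  assumes pi: "partial_isometry H T"
    and eq: "hdim H (op_kernel H T) = hdim H (op_kernel H (adjoint H T))"
    and le: "hdim H (op_kernel H T) \<le> 1"
  shows "complex_symmetric H T"
proof -
  have TS: "adj_pair T (adjoint H T)"
    using pi bounded_op_adj_pair unfolding partial_isometry_def by blast
  obtain e where e: "e \<in> op_kernel H T" "\<langle>e,e\<rangle> = (if hdim H (op_kernel H T) = 0 then 0 else 1)"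
      "\<forall>x\<in>op_kernel H T. \<exists>c. x = c \<odot> e"
    using hdim_le_1_generator[OF subspace_kernel[OF TS] le] by auto
  obtain f where f: "f \<in> op_kernel H (adjoint H T)"
      "\<langle>f,f\<rangle> = (if hdim H (op_kernel H T) = 0 then 0 else 1)"
      "\<forall>x\<in>op_kernel H (adjoint H T). \<exists>c. x = c \<odot> f"
    using hdim_le_1_generator[OF subspace_kernel[OF adj_pair_sym[OF TS]] le[unfolded eq]]
    unfolding eq by auto
  show ?thesis
  proof (rule partial_isometry_complex_symmetric[OF pi, of e f])
    show "\<exists>c. x = c \<odot> e" if "x \<in> carr" "T x = zer" for x
      using e(3) that by (simp add: op_kernel_def)
    show "\<exists>c. x = c \<odot> f" if "x \<in> carr" "adjoint H T x = zer" for x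
      using f(3) that by (simp add: op_kernel_def)
  qed (use e f in \<open>auto simp: op_kernel_def\<close>)
qed

end

section \<open>The sequence spaces\<close>

text \<open>One family for all dimensions: finite \<open>N\<close> gives the N-dimensional space,
  and \<open>N = \<infinity>\<close> imposes no support condition and gives the full sequence
  space.\<close>

definition l2 :: "enat \<Rightarrow> (nat \<Rightarrow> complex) chspace" where
  "l2 N = \<lparr>hs_carrier = {f. summable (\<lambda>i. (cmod (f i))\<^sup>2) \<and> (\<forall>i. N \<le> enat i \<longrightarrow> f i = 0)},
     hs_zero = (\<lambda>_. 0), hs_add = (\<lambda>f g i. f i + g i), hs_scale = (\<lambda>a f i. a * f i),
     hs_inner = (\<lambda>f g. \<Sum>i. f i * cnj (g i))\<rparr>"

abbreviation (input) "sq f \<equiv> \<lambda>i::nat. (cmod (f i))\<^sup>2"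

lemma l2_simps [simp]:
  "f \<in> hs_carrier (l2 N) \<longleftrightarrow> summable (sq f) \<and> (\<forall>i. N \<le> enat i \<longrightarrow> f i = 0)"
  "hs_zero (l2 N) = (\<lambda>_. 0)" "hs_add (l2 N) f g = (\<lambda>i. f i + g i)"
  "hs_scale (l2 N) a f = (\<lambda>i. a * f i)" "hs_diff (l2 N) f g = (\<lambda>i. f i - g i)"
  by (simp_all add: l2_def hs_diff_def)

lemma l2_inner: "hs_inner (l2 N) f g = (\<Sum>i. f i * cnj (g i))"
  by (simp add: l2_def)

lemma summable_sq_add:
  assumes "summable (sq f)" "summable (sq g)"
  shows "summable (sq (\<lambda>i. f i + g i))"
proof (rule summable_comparison_test')
  show "summable (\<lambda>i. 2 * (cmod (f i))\<^sup>2 + 2 * (cmod (g i))\<^sup>2)"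
    using assms by (intro summable_add summable_mult)
  show "norm ((cmod (f i + g i))\<^sup>2) \<le> 2 * (cmod (f i))\<^sup>2 + 2 * (cmod (g i))\<^sup>2" if "i \<ge> 0" for i
  proof -
    have "(cmod (f i + g i))\<^sup>2 \<le> (cmod (f i) + cmod (g i))\<^sup>2"
      by (intro power_mono norm_triangle_ineq) simp
    also have "\<dots> \<le> 2 * (cmod (f i))\<^sup>2 + 2 * (cmod (g i))\<^sup>2"
      using sum_squares_bound[of "cmod (f i)" "cmod (g i)"] by (simp add: power2_sum)
    finally show ?thesis by simp
  qed
qed

lemma summable_sq_scale: "summable (sq f) \<Longrightarrow> summable (sq (\<lambda>i. a * f i))"
  by (simp add: norm_mult power_mult_distrib summable_mult)

lemma summable_sq_diff:
  assumes "summable (sq f)" "summable (sq g)"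
  shows "summable (sq (\<lambda>i. f i - g i))"
  using summable_sq_add[OF assms(1) summable_sq_scale[OF assms(2), of "-1"]] by simp

lemma summable_inner:
  assumes "summable (sq f)" "summable (sq g)"
  shows "summable (\<lambda>i. f i * cnj (g i))"
proof (rule summable_comparison_test')
  show "summable (\<lambda>i. (cmod (f i))\<^sup>2 + (cmod (g i))\<^sup>2)" using assms by (rule summable_add)
  show "norm (f i * cnj (g i)) \<le> (cmod (f i))\<^sup>2 + (cmod (g i))\<^sup>2" if "i \<ge> 0" for i
  proof -
    have "0 \<le> cmod (f i) * cmod (g i)" by simp
    then show ?thesis
      using sum_squares_bound[of "cmod (f i)" "cmod (g i)"] by (simp only: norm_mult complex_mod_cnj)
  qed
qed

lemma l2_inner_self:
  assumes "summable (sq f)"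
  shows "hs_inner (l2 N) f f = of_real (\<Sum>i. (cmod (f i))\<^sup>2)"
  unfolding l2_inner complex_norm_square[symmetric] using suminf_of_real[OF assms, symmetric] by simp

lemma l2_norm:
  assumes "summable (sq f)"
  shows "hs_norm (l2 N) f = sqrt (\<Sum>i. (cmod (f i))\<^sup>2)"
  unfolding hs_norm_def l2_inner_self[OF assms] by simp

lemma inner_space_l2: "complex_inner_space (l2 N)"
  unfolding complex_inner_space_def Let_def
proof (intro conjI ballI allI impI)
  fix f assume "f \<in> hs_carrier (l2 N)"
  then have f: "summable (sq f)" "\<And>i. N \<le> enat i \<Longrightarrow> f i = 0" by simp_all
  show "hs_scale (l2 N) a f \<in> hs_carrier (l2 N)" for a
    using f summable_sq_scale[OF f(1)] by simp
  show "Im (hs_inner (l2 N) f f) = 0" "0 \<le> Re (hs_inner (l2 N) f f)"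
    using l2_inner_self[OF f(1)] suminf_nonneg[OF f(1)] by simp_all
  show "f = hs_zero (l2 N)" if "hs_inner (l2 N) f f = 0"
  proof -
    have "(\<Sum>i. (cmod (f i))\<^sup>2) = 0" using that l2_inner_self[OF f(1)] by (metis of_real_eq_0_iff)
    then have "\<forall>i. (cmod (f i))\<^sup>2 = 0" using suminf_eq_zero_iff[OF f(1)] by simp
    then show ?thesis by auto
  qed
  fix g assume "g \<in> hs_carrier (l2 N)"
  then have g: "summable (sq g)" "\<And>i. N \<le> enat i \<Longrightarrow> g i = 0" by simp_all
  show "hs_add (l2 N) f g \<in> hs_carrier (l2 N)"
    using f g summable_sq_add[OF f(1) g(1)] by simp
  show "hs_inner (l2 N) (hs_scale (l2 N) a f) g = a * hs_inner (l2 N) f g" for a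
    using suminf_mult[OF summable_inner[OF f(1) g(1)], of a] by (simp add: l2_inner mult.assoc)
  have "(\<lambda>i. cnj (g i * cnj (f i))) sums cnj (\<Sum>i. g i * cnj (f i))"
    using summable_sums[OF summable_inner[OF g(1) f(1)]] by (subst sums_cnj)
  then show "hs_inner (l2 N) f g = cnj (hs_inner (l2 N) g f)"
    unfolding l2_inner by (simp add: sums_iff mult.commute)
  fix h assume "h \<in> hs_carrier (l2 N)"
  then have h: "summable (sq h)" by simp
  show "hs_inner (l2 N) (hs_add (l2 N) f g) h = hs_inner (l2 N) f h + hs_inner (l2 N) g h"
    using suminf_add[OF summable_inner[OF f(1) h] summable_inner[OF g(1) h]]
    by (simp add: l2_inner distrib_right)
qed (auto simp: algebra_simps)

text \<open>Coordinatewise limits pass through finite sums. The estimates are therefore kept on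
  partial sums, uniformly in their length \<open>K\<close>, and this uniformity gives back both
  summability and convergence in norm.\<close>

lemma hilbert_space_l2: "hilbert_space (l2 N)"
  unfolding hilbert_space_def
proof (intro conjI allI impI inner_space_l2)
  fix X :: "nat \<Rightarrow> nat \<Rightarrow> complex"
  assume *: "(\<forall>n. X n \<in> hs_carrier (l2 N)) \<and>
      (\<forall>e>0. \<exists>M. \<forall>m\<ge>M. \<forall>n\<ge>M. hs_norm (l2 N) (hs_diff (l2 N) (X m) (X n)) < e)"
  have X: "summable (sq (X n))" and X0: "N \<le> enat i \<Longrightarrow> X n i = 0" for n i using * by auto
  have partial: "(\<Sum>i<K. (cmod (X m i - X n i))\<^sup>2) \<le> (hs_norm (l2 N) (hs_diff (l2 N) (X m) (X n)))\<^sup>2"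
    for m n K
  proof -
    note s = summable_sq_diff[OF X X, of m n]
    have "(\<Sum>i<K. (cmod (X m i - X n i))\<^sup>2) \<le> (\<Sum>i. (cmod (X m i - X n i))\<^sup>2)"
      using s by (intro sum_le_suminf) auto
    also have "\<dots> = (hs_norm (l2 N) (hs_diff (l2 N) (X m) (X n)))\<^sup>2"
      using l2_norm[OF s] suminf_nonneg[OF s] by simp
    finally show ?thesis .
  qed
  have small: "\<exists>M. \<forall>m\<ge>M. \<forall>n\<ge>M. \<forall>K. (\<Sum>i<K. (cmod (X m i - X n i))\<^sup>2) \<le> e\<^sup>2" if e: "e > 0" for e
  proof -
    obtain M where M: "\<And>m n. \<lbrakk>m \<ge> M; n \<ge> M\<rbrakk> \<Longrightarrow> hs_norm (l2 N) (hs_diff (l2 N) (X m) (X n)) < e"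
      using * e by blast
    have "(\<Sum>i<K. (cmod (X m i - X n i))\<^sup>2) \<le> e\<^sup>2" if "m \<ge> M" "n \<ge> M" for m n K
    proof -
      have "0 \<le> hs_norm (l2 N) (hs_diff (l2 N) (X m) (X n))"
        using l2_norm[OF summable_sq_diff[OF X X]] suminf_nonneg[OF summable_sq_diff[OF X X]] by simp
      then have "(hs_norm (l2 N) (hs_diff (l2 N) (X m) (X n)))\<^sup>2 \<le> e\<^sup>2"
        using M[OF that] by (intro power_mono) auto
      then show ?thesis using partial[of m n K] by linarith
    qed
    then show ?thesis by blast
  qed
  have "Cauchy (\<lambda>n. X n i)" for i
  proof (rule CauchyI)
    fix e :: real assume e: "0 < e"
    obtain M where M: "\<And>m n K. \<lbrakk>m \<ge> M; n \<ge> M\<rbrakk> \<Longrightarrow> (\<Sum>i<K. (cmod (X m i - X n i))\<^sup>2) \<le> (e/2)\<^sup>2"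
      using small[of "e/2"] e by auto
    have "norm (X m i - X n i) < e" if mn: "m \<ge> M" "n \<ge> M" for m n
    proof -
      have "(cmod (X m i - X n i))\<^sup>2 \<le> (\<Sum>i<Suc i. (cmod (X m i - X n i))\<^sup>2)"
        by (intro member_le_sum) auto
      also have "\<dots> \<le> (e/2)\<^sup>2" using M mn by blast
      finally have "cmod (X m i - X n i) \<le> e/2" by (rule power2_le_imp_le) (use e in simp)
      then show ?thesis using e by simp
    qed
    then show "\<exists>M. \<forall>m\<ge>M. \<forall>n\<ge>M. norm (X m i - X n i) < e" by blast
  qed
  then have "\<forall>i. \<exists>l. (\<lambda>n. X n i) \<longlonglongrightarrow> l" by (simp add: Cauchy_convergent_iff convergent_def)
  then obtain L where L: "\<And>i. (\<lambda>n. X n i) \<longlonglongrightarrow> L i" by metis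
  have limit: "\<exists>M. \<forall>m\<ge>M. \<forall>K. (\<Sum>i<K. (cmod (X m i - L i))\<^sup>2) \<le> e\<^sup>2" if e: "e > 0" for e
  proof -
    obtain M where M: "\<And>m n K. \<lbrakk>m \<ge> M; n \<ge> M\<rbrakk> \<Longrightarrow> (\<Sum>i<K. (cmod (X m i - X n i))\<^sup>2) \<le> e\<^sup>2"
      using small[OF e] by auto
    have "(\<Sum>i<K. (cmod (X m i - L i))\<^sup>2) \<le> e\<^sup>2" if m: "m \<ge> M" for m K
    proof (rule LIMSEQ_le_const2)
      show "(\<lambda>n. \<Sum>i<K. (cmod (X m i - X n i))\<^sup>2) \<longlonglongrightarrow> (\<Sum>i<K. (cmod (X m i - L i))\<^sup>2)"
        by (intro tendsto_sum tendsto_power tendsto_norm tendsto_diff tendsto_const L)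
      show "\<exists>M. \<forall>n\<ge>M. (\<Sum>i<K. (cmod (X m i - X n i))\<^sup>2) \<le> e\<^sup>2" using M m by blast
    qed
    then show ?thesis by blast
  qed
  have sumXL: "summable (sq (\<lambda>i. X m i - L i))" if "\<And>K. (\<Sum>i<K. (cmod (X m i - L i))\<^sup>2) \<le> e\<^sup>2" for m e
    using that by (intro summableI_nonneg_bounded[where x = "e\<^sup>2"]) auto
  show "\<exists>l\<in>hs_carrier (l2 N). \<forall>e>0. \<exists>M. \<forall>n\<ge>M. hs_norm (l2 N) (hs_diff (l2 N) (X n) l) < e"
  proof (intro bexI allI impI)
    obtain m where m: "\<And>K. (\<Sum>i<K. (cmod (X m i - L i))\<^sup>2) \<le> 1\<^sup>2"
      using limit[of 1] by auto
    \<comment> \<open>\<open>L\<close> is the difference of \<open>X m\<close> and X m - L, both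
      square summable.\<close>
    have "summable (sq L)" using summable_sq_diff[OF X[of m] sumXL[OF m]] by simp
    moreover have "L i = 0" if "N \<le> enat i" for i
      using L[of i] X0[OF that] by (simp add: LIMSEQ_const_iff)
    ultimately show "L \<in> hs_carrier (l2 N)" by simp
    fix e :: real assume e: "e > 0"
    obtain M where M: "\<And>m K. m \<ge> M \<Longrightarrow> (\<Sum>i<K. (cmod (X m i - L i))\<^sup>2) \<le> (e/2)\<^sup>2"
      using limit[of "e/2"] e by auto
    have "hs_norm (l2 N) (hs_diff (l2 N) (X n) L) < e" if n: "n \<ge> M" for n
    proof -
      note s = sumXL[OF M[OF n]]
      have "(\<Sum>i. (cmod (X n i - L i))\<^sup>2) \<le> (e/2)\<^sup>2" using s M[OF n] by (rule suminf_le_const)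
      then have "sqrt (\<Sum>i. (cmod (X n i - L i))\<^sup>2) \<le> sqrt ((e/2)\<^sup>2)"
        by (rule real_sqrt_le_mono)
      then show ?thesis using l2_norm[OF s] e by simp
    qed
    then show "\<exists>M. \<forall>n\<ge>M. hs_norm (l2 N) (hs_diff (l2 N) (X n) L) < e" by blast
  qed
qed

section \<open>Separability of the sequence spaces\<close>

definition rat_complex :: "rat \<times> rat \<Rightarrow> complex" where
  "rat_complex q = Complex (of_rat (fst q)) (of_rat (snd q))"

lemma rat_complex_dense:
  assumes "e > 0"
  shows "\<exists>q. cmod (z - rat_complex q) < e"
proof -
  obtain a where a: "Re z - e/2 < of_rat a" "of_rat a < Re z"
    using of_rat_dense[of "Re z - e/2" "Re z"] assms by auto
  obtain b where b: "Im z - e/2 < of_rat b" "of_rat b < Im z"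
    using of_rat_dense[of "Im z - e/2" "Im z"] assms by auto
  have "cmod (z - rat_complex (a, b)) \<le> \<bar>Re z - of_rat a\<bar> + \<bar>Im z - of_rat b\<bar>"
    using cmod_le[of "z - rat_complex (a, b)"] by (simp add: rat_complex_def)
  also have "\<dots> < e" using a b by linarith
  finally show ?thesis by blast
qed

lemma separable_l2: "separable (l2 N)"
proof -
  define seq where "seq xs = (\<lambda>i. if i < length xs \<and> enat i < N then rat_complex (xs ! i) else 0)"
    for xs :: "(rat \<times> rat) list"
  have sq_seq: "summable (sq (seq xs))" for xs
    by (rule summable_finite[of "{..<length xs}"]) (auto simp: seq_def)
  show ?thesis
    unfolding separable_def
  proof (intro exI[of _ "range seq"] conjI ballI allI impI)
    show "range seq \<subseteq> hs_carrier (l2 N)"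
      using sq_seq by (auto simp: seq_def)
    show "countable (range seq)" by (rule countable_image[OF countableI_type])
    fix x and e :: real assume x: "x \<in> hs_carrier (l2 N)" and e: "e > 0"
    then have sx: "summable (sq x)" and x0: "\<And>i. N \<le> enat i \<Longrightarrow> x i = 0" by simp_all
    obtain K where K: "norm (\<Sum>i. (cmod (x (i + K)))\<^sup>2) < e\<^sup>2 / 2"
      using suminf_exist_split[OF _ sx, of "e\<^sup>2 / 2"] e by auto
    \<comment> \<open>The first \<open>K\<close> entries may contribute K d^2, at most half of e^2;
      the tail takes the other half. The summand 1 covers \<open>K = 0\<close>.\<close>
    define d where "d = sqrt (e\<^sup>2 / (2 * (real K + 1)))"
    have d: "d > 0" "d\<^sup>2 = e\<^sup>2 / (2 * (real K + 1))" using e by (simp_all add: d_def)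
    have "\<forall>i. \<exists>q. cmod (x i - rat_complex q) < d" using rat_complex_dense[OF d(1)] by blast
    then obtain q where q: "\<And>i. cmod (x i - rat_complex (q i)) < d" by metis
    define y where "y = seq (map q [0..<K])"
    note s = summable_sq_diff[OF sx sq_seq, of "map q [0..<K]", folded y_def]
    have "(cmod (x i - y i))\<^sup>2 \<le> d\<^sup>2" if "i < K" for i
    proof (cases "enat i < N")
      case True
      then show ?thesis using that q[of i] by (intro power_mono) (auto simp: y_def seq_def)
    next
      case False
      then show ?thesis using x0[of i] by (simp add: y_def seq_def)
    qed
    then have "(\<Sum>i<K. (cmod (x i - y i))\<^sup>2) \<le> real K * d\<^sup>2"
      using sum_bounded_above[of "{..<K}" "\<lambda>i. (cmod (x i - y i))\<^sup>2" "d\<^sup>2"] by simp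
    also have "\<dots> \<le> (real K + 1) * d\<^sup>2" by (intro mult_right_mono) auto
    also have "\<dots> = e\<^sup>2 / 2" unfolding d(2) by (simp add: field_simps)
    finally have head: "(\<Sum>i<K. (cmod (x i - y i))\<^sup>2) \<le> e\<^sup>2 / 2" .
    have "(\<Sum>i. (cmod (x i - y i))\<^sup>2) = (\<Sum>i. (cmod (x (i + K) - y (i + K)))\<^sup>2) + (\<Sum>i<K. (cmod (x i - y i))\<^sup>2)"
      using s by (rule suminf_split_initial_segment)
    also have "(\<Sum>i. (cmod (x (i + K) - y (i + K)))\<^sup>2) = (\<Sum>i. (cmod (x (i + K)))\<^sup>2)"
      by (simp add: y_def seq_def)
    finally have "(\<Sum>i. (cmod (x i - y i))\<^sup>2) < e\<^sup>2" using head K by (simp add: abs_if split: if_splits)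
    then have "sqrt (\<Sum>i. (cmod (x i - y i))\<^sup>2) < sqrt (e\<^sup>2)" by (rule real_sqrt_less_mono)
    then have "hs_norm (l2 N) (hs_diff (l2 N) x y) < e" using l2_norm[OF s] e by simp
    then show "\<exists>d\<in>range seq. hs_norm (l2 N) (hs_diff (l2 N) x d) < e"
      unfolding y_def by blast
  qed
qed

section \<open>Examples with larger kernels\<close>

context complex_ip
begin

text \<open>Removing the component of \<open>x\<close> along \<open>b\<close> leaves the
  coefficients for the remaining vectors unchanged and lowers the squared norm by exactly one term;
  hence \<open>x\<close> varies in the induction.\<close>

lemma Bessel:
  assumes "finite B" "orthonormal H B" "x \<in> carr"
  shows "(\<Sum>b\<in>B. (cmod \<langle>x,b\<rangle>)\<^sup>2) \<le> (nrm x)\<^sup>2"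
  using assms
proof (induction B arbitrary: x rule: finite_induct)
  case empty
  then show ?case by simp
next
  case (insert b B)
  have b: "b \<in> carr" "\<langle>b,b\<rangle> = 1" and B: "orthonormal H B"
    using insert.prems by (auto simp: orthonormal_def)
  define y where "y = x \<ominus> \<langle>x,b\<rangle> \<odot> b"
  have y: "y \<in> carr" unfolding y_def using insert.prems b by simp
  have "\<langle>y,c\<rangle> = \<langle>x,c\<rangle>" if c: "c \<in> B" for c
  proof -
    have "\<langle>b,c\<rangle> = 0" "c \<in> carr" using insert.prems(1) insert.hyps(2) c by (auto simp: orthonormal_def)
    then show ?thesis unfolding y_def using b insert.prems by simp
  qed
  then have "(\<Sum>c\<in>B. (cmod \<langle>x,c\<rangle>)\<^sup>2) = (\<Sum>c\<in>B. (cmod \<langle>y,c\<rangle>)\<^sup>2)" by simp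
  also have "\<dots> \<le> (nrm y)\<^sup>2" using insert.IH[OF B y] .
  also have "\<dots> = (nrm x)\<^sup>2 - (cmod \<langle>x,b\<rangle>)\<^sup>2"
  proof -
    have "nrm b = 1" unfolding hs_norm_def b(2) by simp
    then show ?thesis
      using orth_residual_sq[of x b] b insert.prems(2) nrm_sq[OF y] unfolding y_def by simp
  qed
  finally show ?case using insert.hyps by simp
qed

text \<open>Parseval's identity is asked for only in finite dimension, where it yields the upper
  bound. An infinite \<phi> already provides orthonormal sets of every finite size.\<close>

lemma hdim_eqI:
  assumes S: "S \<subseteq> carr" and mem: "\<And>i. enat i < n \<Longrightarrow> \<phi> i \<in> S"
    and orth: "\<And>i j. \<lbrakk>enat i < n; enat j < n\<rbrakk> \<Longrightarrow> \<langle>\<phi> i,\<phi> j\<rangle> = (if i = j then 1 else 0)"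
    and total: "\<And>k x. \<lbrakk>n = enat k; x \<in> S\<rbrakk> \<Longrightarrow> (nrm x)\<^sup>2 = (\<Sum>i<k. (cmod \<langle>x,\<phi> i\<rangle>)\<^sup>2)"
  shows "hdim H S = n"
proof (rule antisym)
  have ge: "enat k \<le> hdim H S" if k: "enat k \<le> n" for k
  proof -
    have lt: "enat i < n" if "i < k" for i
      using that k by (metis enat_ord_simps(2) less_le_trans)
    have "\<phi> i \<noteq> \<phi> j" if "i < k" "j < k" "i \<noteq> j" for i j
      using orth[OF lt lt, of i j] orth[OF lt lt, of i i] that by auto
    then have "inj_on \<phi> {..<k}" by (auto simp: inj_on_def)
    then have card: "card (\<phi> ` {..<k}) = k" by (simp add: card_image)
    have "enat (card (\<phi> ` {..<k})) \<le> hdim H S"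
    proof (rule hdim_ge)
      show "\<phi> ` {..<k} \<subseteq> S" using mem lt by auto
      then show "orthonormal H (\<phi> ` {..<k})"
        unfolding orthonormal_def using S orth lt by auto
    qed simp
    then show ?thesis using card by simp
  qed
  show "n \<le> hdim H S"
  proof (cases n)
    case (enat k)
    then show ?thesis using ge[of k] by simp
  next
    case infinity
    then have "hdim H S \<noteq> enat m" for m
      using ge[of "Suc m"] by auto
    then show ?thesis by (cases "hdim H S") auto
  qed
  show "hdim H S \<le> n"
  proof (cases n)
    case (enat k)
    show ?thesis
    proof (rule hdim_le)
      fix B assume B: "finite B" "B \<subseteq> S" "orthonormal H B"
      have Bc: "b \<in> carr" if "b \<in> B" for b using B S that by blast
      have \<phi>c: "\<phi> i \<in> carr" "nrm (\<phi> i) = 1" if "i < k" for i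
        using that mem[of i] orth[of i i] S enat by (auto simp: hs_norm_def)
      \<comment> \<open>Double counting: expand each unit vector of \<open>B\<close> by Parseval,
        exchange the sums, and bound each inner sum by Bessel for \<open>B\<close>.\<close>
      have "real (card B) = (\<Sum>b\<in>B. (nrm b)\<^sup>2)"
        using B(3) by (simp add: orthonormal_def hs_norm_def)
      also have "\<dots> = (\<Sum>b\<in>B. \<Sum>i<k. (cmod \<langle>b,\<phi> i\<rangle>)\<^sup>2)"
        using total[OF enat] B(2) by (intro sum.cong) auto
      also have "\<dots> = (\<Sum>i<k. \<Sum>b\<in>B. (cmod \<langle>b,\<phi> i\<rangle>)\<^sup>2)" by (rule sum.swap)
      also have "\<dots> = (\<Sum>i<k. \<Sum>b\<in>B. (cmod \<langle>\<phi> i,b\<rangle>)\<^sup>2)"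
      proof (intro sum.cong refl)
        fix i b assume "i \<in> {..<k}" "b \<in> B"
        then have "\<langle>b,\<phi> i\<rangle> = cnj \<langle>\<phi> i,b\<rangle>" using \<phi>c Bc by (intro ip_commute) auto
        then show "(cmod \<langle>b,\<phi> i\<rangle>)\<^sup>2 = (cmod \<langle>\<phi> i,b\<rangle>)\<^sup>2" by (simp only: complex_mod_cnj)
      qed
      also have "\<dots> \<le> (\<Sum>i<k. 1)"
      proof (rule sum_mono)
        fix i assume i: "i \<in> {..<k}"
        show "(\<Sum>b\<in>B. (cmod \<langle>\<phi> i,b\<rangle>)\<^sup>2) \<le> 1"
          using Bessel[OF B(1,3), of "\<phi> i"] \<phi>c[of i] i by simp
      qed
      finally show "enat (card B) \<le> n" using enat by simp
    qed
  qed simp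
qed

lemma adj_pair_adjoint: "\<lbrakk>adj_pair T S; y \<in> carr\<rbrakk> \<Longrightarrow> adjoint H T y = S y"
  using adjoint_eqI[of S T y] adj_pair_carr[OF adj_pair_sym] adj_pair_ip by blast

text \<open>Boundedness comes from idempotence: \<open>S T\<close> is a symmetric idempotent, so the
  squared norm of \<open>T x\<close> equals \<langle>x, S (T x)\<rangle>, which is at most
  \<langle>x,x\<rangle>.\<close>

lemma partial_isometryI:
  assumes TS: "adj_pair T S" and idem: "\<And>x. x \<in> carr \<Longrightarrow> S (T (S (T x))) = S (T x)"
  shows "partial_isometry H T"
proof -
  note ST = adj_pair_sym[OF TS]
  note Tc = adj_pair_carr[OF TS] and Sc = adj_pair_carr[OF ST]
  note adj = adj_pair_adjoint[OF TS]
  have P_ip: "\<langle>S (T x),y\<rangle> = \<langle>x,S (T y)\<rangle>" if "x \<in> carr" "y \<in> carr" for x y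
    using adj_pair_ip[OF ST Tc that(2)] adj_pair_ip[OF TS _ Tc] that Tc by simp
  have P_le: "Re \<langle>x,S (T x)\<rangle> \<le> Re \<langle>x,x\<rangle>" and P_self: "\<langle>S (T x),S (T x)\<rangle> = \<langle>x,S (T x)\<rangle>"
    if x: "x \<in> carr" for x
  proof -
    have Px: "S (T x) \<in> carr" using x Tc Sc by simp
    show self: "\<langle>S (T x),S (T x)\<rangle> = \<langle>x,S (T x)\<rangle>" using P_ip[OF x Px] idem[OF x] by simp
    have "\<langle>x \<ominus> S (T x),x \<ominus> S (T x)\<rangle> = \<langle>x,x\<rangle> - \<langle>x,S (T x)\<rangle>"
      using x Px self P_ip[OF x x] by simp
    then show "Re \<langle>x,S (T x)\<rangle> \<le> Re \<langle>x,x\<rangle>"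
      using ip_self_Re[OF diff_carr[OF x Px]] by simp
  qed
  have "nrm (T x) \<le> 1 * nrm x" "nrm (S (T x)) \<le> 1 * nrm x" if x: "x \<in> carr" for x
    using adj_pair_ip[OF TS x Tc[OF x]] P_le[OF x] P_self[OF x] by (simp_all add: hs_norm_def)
  then have bdd: "\<exists>K. \<forall>x\<in>carr. nrm (T x) \<le> K * nrm x" "\<exists>K. \<forall>x\<in>carr. nrm (S (T x)) \<le> K * nrm x"
    by blast+
  have T: "bounded_op H T"
    unfolding bounded_op_def using Tc adj_pair_add[OF TS] adj_pair_scale[OF TS] bdd(1) by simp
  have "bounded_op H (adjoint H T \<circ> T)"
    unfolding bounded_op_def using Tc Sc adj_pair_add[OF TS] adj_pair_scale[OF TS]
      adj_pair_add[OF ST] adj_pair_scale[OF ST] bdd(2) by (simp add: adj)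
  then show ?thesis
    unfolding partial_isometry_def orth_projection_def
    using T Tc Sc idem P_ip by (simp add: adj)
qed

lemma adj_pair_op_kernel: "adj_pair T S \<Longrightarrow> op_kernel H (adjoint H T) = op_kernel H S"
  by (auto simp: op_kernel_def adj_pair_adjoint)

end

section \<open>Concrete operators on the sequence spaces\<close>

global_interpretation l2: complex_ip "l2 N" for N
  by unfold_locales (rule inner_space_l2)

definition unit :: "nat \<Rightarrow> nat \<Rightarrow> complex" where
  "unit j = (\<lambda>i. if i = j then 1 else 0)"

lemma unit_carr: "enat j < N \<Longrightarrow> unit j \<in> hs_carrier (l2 N)"
  using summable_finite[of "{j}" "sq (unit j)"] by (auto simp: unit_def)

lemma inner_unit: "hs_inner (l2 N) x (unit j) = x j"
  unfolding l2_inner by (subst suminf_finite[of "{j}"]) (auto simp: unit_def)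

lemma l2_norm_sq_finite:
  assumes "\<And>i. k \<le> i \<Longrightarrow> x i = 0"
  shows "(hs_norm (l2 N) x)\<^sup>2 = (\<Sum>i<k. (cmod (x i))\<^sup>2)"
proof -
  have s: "summable (sq x)" using assms by (intro summable_finite[of "{..<k}"]) auto
  have "(hs_norm (l2 N) x)\<^sup>2 = (\<Sum>i. (cmod (x i))\<^sup>2)"
    using suminf_nonneg[OF s] by (simp add: l2_norm[OF s])
  also have "\<dots> = (\<Sum>i<k. (cmod (x i))\<^sup>2)" using assms by (intro suminf_finite) auto
  finally show ?thesis .
qed

lemma hdim_l2: "hdim (l2 n) (hs_carrier (l2 n)) = n"
proof (rule l2.hdim_eqI[where \<phi> = unit])
  show "hs_inner (l2 n) (unit i) (unit j) = (if i = j then 1 else 0)" for i j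
    unfolding inner_unit by (simp add: unit_def)
  show "(hs_norm (l2 n) x)\<^sup>2 = (\<Sum>i<k. (cmod (hs_inner (l2 n) x (unit i)))\<^sup>2)"
    if "n = enat k" "x \<in> hs_carrier (l2 n)" for k x
    unfolding inner_unit using that by (intro l2_norm_sq_finite) auto
qed (use unit_carr in blast)+

lemma zero_op_example:
  shows "partial_isometry (l2 n) (\<lambda>_ _. 0)" "complex_symmetric (l2 n) (\<lambda>_ _. 0)"
    "hdim (l2 n) (op_kernel (l2 n) (\<lambda>_ _. 0)) = n"
    "hdim (l2 n) (op_kernel (l2 n) (adjoint (l2 n) (\<lambda>_ _. 0))) = n"
proof -
  let ?Z = "\<lambda>(_::nat \<Rightarrow> complex) (_::nat). 0 :: complex"
  have Z: "l2.adj_pair n ?Z ?Z"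
    unfolding l2.adj_pair_def by (simp add: l2_inner)
  show "partial_isometry (l2 n) ?Z" using Z by (rule l2.partial_isometryI) simp
  have ker: "op_kernel (l2 n) ?Z = hs_carrier (l2 n)" by (auto simp: op_kernel_def)
  show "hdim (l2 n) (op_kernel (l2 n) ?Z) = n"
    "hdim (l2 n) (op_kernel (l2 n) (adjoint (l2 n) ?Z)) = n"
    unfolding l2.adj_pair_op_kernel[OF Z] ker by (rule hdim_l2)+
  define C where "C f = (\<lambda>i. cnj (f i))" for f :: "nat \<Rightarrow> complex"
  have "conjugation (l2 n) C"
    unfolding conjugation_def by (auto simp: C_def l2_norm)
  moreover have "?Z x = C (adjoint (l2 n) ?Z (C x))" if "x \<in> hs_carrier (l2 n)" for x
  proof -
    have "C x \<in> hs_carrier (l2 n)" using that by (simp add: C_def)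
    from l2.adj_pair_adjoint[OF Z this] show ?thesis by (simp add: C_def)
  qed
  ultimately show "complex_symmetric (l2 n) ?Z" unfolding complex_symmetric_def by blast
qed

text \<open>The compression to the span of the first three basis vectors is a weighted shift with the
  non-palindromic weights \<open>1, 3/5\<close>, which is not complex symmetric.\<close>
definition shift_op :: "(nat \<Rightarrow> complex) \<Rightarrow> nat \<Rightarrow> complex" where
  "shift_op f = (\<lambda>i. if i = 1 then f 0 else if i = 2 then 3/5 * f 1 else if i = 3 then 4/5 * f 1
     else if i = 4 then f 2 else 0)"

definition shift_adj :: "(nat \<Rightarrow> complex) \<Rightarrow> nat \<Rightarrow> complex" where
  "shift_adj f = (\<lambda>i. if i = 0 then f 1 else if i = 1 then 3/5 * f 2 + 4/5 * f 3
     else if i = 2 then f 4 else 0)"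

lemma inner_finite:
  assumes "\<And>i. 5 \<le> i \<Longrightarrow> f i * cnj (g i) = 0"
  shows "hs_inner (l2 N) f g
    = f 0 * cnj (g 0) + f 1 * cnj (g 1) + f 2 * cnj (g 2) + f 3 * cnj (g 3) + f 4 * cnj (g 4)"
proof -
  have "hs_inner (l2 N) f g = (\<Sum>i<5. f i * cnj (g i))"
    unfolding l2_inner using assms by (intro suminf_finite) auto
  then show ?thesis by (simp add: eval_nat_numeral)
qed

lemma shift_adj_pair:
  assumes "5 \<le> N"
  shows "l2.adj_pair N shift_op shift_adj"
  unfolding l2.adj_pair_def
proof (intro conjI ballI)
  have N: "\<not> N \<le> enat i" if "i < 5" for i
  proof -
    have "enat i < 5" using that by (simp add: numeral_eq_enat)
    then show ?thesis using assms by (meson less_le_trans not_le)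
  qed
  fix x assume "x \<in> hs_carrier (l2 N)"
  have "summable (sq (shift_op x))" "summable (sq (shift_adj x))"
    by (rule summable_finite[of "{..<5}"]; auto simp: shift_op_def shift_adj_def)+
  then show "shift_op x \<in> hs_carrier (l2 N)" "shift_adj x \<in> hs_carrier (l2 N)"
    using N[of 0] N[of 1] N[of 2] N[of 3] N[of 4] by (auto simp: shift_op_def shift_adj_def)
  fix y assume "y \<in> hs_carrier (l2 N)"
  show "hs_inner (l2 N) (shift_op x) y = hs_inner (l2 N) x (shift_adj y)"
    by (subst (1 2) inner_finite) (auto simp: shift_op_def shift_adj_def algebra_simps)
qed

text \<open>The images of \<open>unit 0\<close>, \<open>unit 1\<close>, \<open>unit 2\<close> are
  orthonormal because 9/25 + 16/25 = 1, and all other basis vectors are mapped to zero.\<close>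

lemma shift_partial_isometry:
  assumes "5 \<le> N"
  shows "partial_isometry (l2 N) shift_op"
  using shift_adj_pair[OF assms]
  by (rule l2.partial_isometryI) (auto simp: shift_op_def shift_adj_def fun_eq_iff)

text \<open>The kernel consists of the sequences vanishing at 0, 1 and 2, hence the shift of the
  basis index by 3. Infinite \<open>n\<close> is included, as then \<open>n + 3 = n\<close>.\<close>

lemma hdim_kernel_shift: "hdim (l2 (n + 3)) (op_kernel (l2 (n + 3)) shift_op) = n"
proof (rule l2.hdim_eqI[where \<phi> = "\<lambda>i. unit (i + 3)"])
  have ker: "x \<in> op_kernel (l2 (n + 3)) shift_op \<longleftrightarrow>
      x \<in> hs_carrier (l2 (n + 3)) \<and> x 0 = 0 \<and> x 1 = 0 \<and> x 2 = 0" for x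
    unfolding op_kernel_def by (auto simp: shift_op_def fun_eq_iff)
  show "op_kernel (l2 (n + 3)) shift_op \<subseteq> hs_carrier (l2 (n + 3))"
    by (auto simp: op_kernel_def)
  show "unit (i + 3) \<in> op_kernel (l2 (n + 3)) shift_op" if "enat i < n" for i
  proof -
    have "enat (i + 3) < n + 3" using that by (cases n) (auto simp: numeral_eq_enat)
    then show ?thesis unfolding ker using unit_carr by (auto simp: unit_def)
  qed
  show "hs_inner (l2 (n + 3)) (unit (i + 3)) (unit (j + 3)) = (if i = j then 1 else 0)" for i j
    unfolding inner_unit by (simp add: unit_def)
  fix k x assume k: "n = enat k" and x: "x \<in> op_kernel (l2 (n + 3)) shift_op"
  have "(hs_norm (l2 (n + 3)) x)\<^sup>2 = (\<Sum>i<Suc (Suc (Suc k)). (cmod (x i))\<^sup>2)"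
    using x k by (intro l2_norm_sq_finite) (auto simp: op_kernel_def numeral_eq_enat)
  also have "\<dots> = (\<Sum>i<k. (cmod (x (i + 3)))\<^sup>2)"
    using x unfolding ker by (simp only: sum.lessThan_Suc_shift) (simp add: eval_nat_numeral)
  finally show "(hs_norm (l2 (n + 3)) x)\<^sup>2 = (\<Sum>i<k. (cmod (hs_inner (l2 (n + 3)) x (unit (i + 3))))\<^sup>2)"
    unfolding inner_unit .
qed

lemma hdim_kernel_shift_adj:
  assumes "2 \<le> n"
  shows "hdim (l2 (n + 3)) (op_kernel (l2 (n + 3)) shift_adj) = n"
proof -
  \<comment> \<open>The unit vector orthogonal to 3/5 \<open>unit 2\<close> + 4/5
    \<open>unit 3\<close>, the image of \<open>unit 1\<close>.\<close>
  define \<psi> where "\<psi> = (\<lambda>i. 4/5 * unit 2 i + (-3/5) * unit 3 i)"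
  \<comment> \<open>From index 2 on the basis continues with \<open>unit 5\<close>: positions 1 and
    4 belong to the range of the shift, and positions 2 and 3 contribute only \<psi>.\<close>
  define \<phi> where "\<phi> i = (if i = 0 then unit 0 else if i = 1 then \<psi> else unit (i + 3))" for i
  have uc: "unit j \<in> hs_carrier (l2 (n + 3))" if "j < 5" for j
  proof (rule unit_carr)
    have "enat j < 5" using that by (simp add: numeral_eq_enat)
    also have "5 \<le> n + 3" using assms by (cases n) (auto simp: numeral_eq_enat)
    finally show "enat j < n + 3" .
  qed
  have \<psi>_eq: "\<psi> = hs_add (l2 (n + 3)) (hs_scale (l2 (n + 3)) (4/5) (unit 2)) (hs_scale (l2 (n + 3)) (-3/5) (unit 3))"
    by (simp add: \<psi>_def)
  have \<psi>c: "\<psi> \<in> hs_carrier (l2 (n + 3))"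
    unfolding \<psi>_eq using uc[of 2] uc[of 3] by (intro l2.add_carr l2.scale_carr) auto
  have ip\<psi>: "hs_inner (l2 (n + 3)) x \<psi> = 4/5 * x 2 - 3/5 * x 3" if "x \<in> hs_carrier (l2 (n + 3))" for x
  proof -
    have "hs_inner (l2 (n + 3)) x \<psi> = cnj (4/5) * hs_inner (l2 (n + 3)) x (unit 2) + cnj (-3/5) * hs_inner (l2 (n + 3)) x (unit 3)"
      unfolding \<psi>_eq using that uc[of 2] uc[of 3]
      by (simp only: l2.ip_add_right l2.ip_scale_right l2.scale_carr)
    then show ?thesis by (simp add: inner_unit)
  qed
  have ip\<phi>: "hs_inner (l2 (n + 3)) x (\<phi> i) = (if i = 0 then x 0 else if i = 1 then 4/5 * x 2 - 3/5 * x 3 else x (i + 3))"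
    if "x \<in> hs_carrier (l2 (n + 3))" for x i
    unfolding \<phi>_def using ip\<psi>[OF that] by (simp add: inner_unit)
  have ker: "x \<in> op_kernel (l2 (n + 3)) shift_adj \<longleftrightarrow>
      x \<in> hs_carrier (l2 (n + 3)) \<and> x 1 = 0 \<and> 3/5 * x 2 + 4/5 * x 3 = 0 \<and> x 4 = 0" for x
    unfolding op_kernel_def by (auto simp: shift_adj_def fun_eq_iff)
  have \<phi>c: "\<phi> i \<in> hs_carrier (l2 (n + 3))" if "enat i < n" for i
  proof -
    have "enat (i + 3) < n + 3" using that by (cases n) (auto simp: numeral_eq_enat)
    then show ?thesis unfolding \<phi>_def using unit_carr[of "i + 3"] uc[of 0] \<psi>c by auto
  qed
  show ?thesis
  proof (rule l2.hdim_eqI[where \<phi> = \<phi>])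
    show "op_kernel (l2 (n + 3)) shift_adj \<subseteq> hs_carrier (l2 (n + 3))"
      by (auto simp: op_kernel_def)
    show "\<phi> i \<in> op_kernel (l2 (n + 3)) shift_adj" if "enat i < n" for i
      unfolding ker using \<phi>c[OF that] by (auto simp: \<phi>_def \<psi>_def unit_def)
    show "hs_inner (l2 (n + 3)) (\<phi> i) (\<phi> j) = (if i = j then 1 else 0)" if "enat i < n" "enat j < n" for i j
      unfolding ip\<phi>[OF \<phi>c[OF that(1)]] by (auto simp: \<phi>_def \<psi>_def unit_def)
    fix k x assume k: "n = enat k" and x: "x \<in> op_kernel (l2 (n + 3)) shift_adj"
    have xc: "x \<in> hs_carrier (l2 (n + 3))" and x1: "x 1 = 0" and x4: "x 4 = 0"
      and x23: "3/5 * x 2 + 4/5 * x 3 = 0" using x unfolding ker by auto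
    obtain m where m: "k = Suc (Suc m)"
      using assms k by (cases k; cases "k - 1") (auto simp: numeral_eq_enat)
    \<comment> \<open>On the kernel the coefficient along \<psi> carries the whole norm of entries 2
      and 3, since 25/9 = 16/9 + 1.\<close>
    have x2: "x 2 = - (4/3) * x 3" using x23 by (simp add: field_simps add_eq_0_iff)
    have "4/5 * x 2 - 3/5 * x 3 = - (5/3) * x 3" unfolding x2 by (simp add: field_simps)
    then have sq23: "(cmod (4/5 * x 2 - 3/5 * x 3))\<^sup>2 = (cmod (x 2))\<^sup>2 + (cmod (x 3))\<^sup>2"
      unfolding x2 by (simp add: norm_mult power_mult_distrib power2_eq_square)
    have "(hs_norm (l2 (n + 3)) x)\<^sup>2 = (\<Sum>i<Suc (Suc (Suc (Suc (Suc m)))). (cmod (x i))\<^sup>2)"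
      using xc k m by (intro l2_norm_sq_finite) (auto simp: numeral_eq_enat)
    also have "\<dots> = (cmod (x 0))\<^sup>2 + (cmod (x 1))\<^sup>2 + (cmod (x 2))\<^sup>2 + (cmod (x 3))\<^sup>2 + (cmod (x 4))\<^sup>2
        + (\<Sum>i<m. (cmod (x (i + 5)))\<^sup>2)"
      by (simp only: sum.lessThan_Suc_shift) (simp add: eval_nat_numeral)
    also have "\<dots> = (cmod (x 0))\<^sup>2 + (cmod (4/5 * x 2 - 3/5 * x 3))\<^sup>2 + (\<Sum>i<m. (cmod (x (i + 5)))\<^sup>2)"
      unfolding sq23 x1 x4 by simp
    also have "\<dots> = (\<Sum>i<k. (cmod (hs_inner (l2 (n + 3)) x (\<phi> i)))\<^sup>2)"
      unfolding m ip\<phi>[OF xc] by (simp only: sum.lessThan_Suc_shift) (simp add: eval_nat_numeral)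
    finally show "(hs_norm (l2 (n + 3)) x)\<^sup>2 = (\<Sum>i<k. (cmod (hs_inner (l2 (n + 3)) x (\<phi> i)))\<^sup>2)" .
  qed
qed

text \<open>A symmetrising conjugation \<open>C\<close> maps \<open>ran T\<^sup>*\<^sup>3\<close>, spanned by \<open>e\<^sub>0\<close>, to \<open>ran T\<^sup>3\<close>, spanned by \<open>e\<^sub>4\<close>,
  and hence \<open>T\<^sup>2 e\<^sub>0\<close>, of norm \<open>1\<close>, to a multiple of \<open>T\<^sup>*\<^sup>2 e\<^sub>4\<close>, of norm \<open>3/5\<close>.\<close>
lemma shift_not_complex_symmetric:
  assumes N: "5 \<le> N"
  shows "\<not> complex_symmetric (l2 N) shift_op"
proof
  assume "complex_symmetric (l2 N) shift_op"
  then obtain C where C: "conjugation (l2 N) C"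
    and TC: "\<And>x. x \<in> hs_carrier (l2 N) \<Longrightarrow> shift_op x = C (adjoint (l2 N) shift_op (C x))"
    unfolding complex_symmetric_def by blast
  let ?T = shift_op and ?S = shift_adj
  note TS = shift_adj_pair[OF N]
  note Tc = l2.adj_pair_carr[OF TS] and Sc = l2.adj_pair_carr[OF l2.adj_pair_sym[OF TS]]
  note Cc = l2.conjugation_carr[OF C] and CC = l2.conjugation_invol[OF C]
  have T_eq: "?T x = C (?S (C x))" if x: "x \<in> hs_carrier (l2 N)" for x
    using TC[OF x] l2.adj_pair_adjoint[OF TS Cc[OF x]] by simp
  have CT: "C (?T x) = ?S (C x)" if x: "x \<in> hs_carrier (l2 N)" for x
    using T_eq[OF x] CC[OF Sc[OF Cc[OF x]]] by simp
  have CS: "C (?S x) = ?T (C x)" if x: "x \<in> hs_carrier (l2 N)" for x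
    using T_eq[OF Cc[OF x]] CC[OF x] by simp
  have uc: "unit j \<in> hs_carrier (l2 N)" if "j < 5" for j
  proof (rule unit_carr)
    have "enat j < 5" using that by (simp add: numeral_eq_enat)
    then show "enat j < N" using N by (rule less_le_trans)
  qed
  have e0: "unit 0 \<in> hs_carrier (l2 N)" and e4: "unit 4 \<in> hs_carrier (l2 N)" using uc by auto
  define h where "h = C (unit 0)"
  have hc: "h \<in> hs_carrier (l2 N)" unfolding h_def using Cc[OF e0] .
  \<comment> \<open>The path goes from \<open>unit 4\<close> to \<open>unit 2\<close>, then to 3/5
    \<open>unit 1\<close>, then to 3/5 \<open>unit 0\<close>. Applying \<open>C\<close> exchanges
    \<open>?S\<close> for \<open>?T\<close>, so \<open>h\<close> lies in the range of the third
    power of \<open>?T\<close>, where only entry 4 can be nonzero.\<close>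
  have "?S (?S (?S (unit 4))) = hs_scale (l2 N) (3/5) (unit 0)"
    by (auto simp: shift_adj_def unit_def fun_eq_iff)
  then have "hs_scale (l2 N) (cnj (3/5)) h = ?T (?T (?T (C (unit 4))))"
    using CS[OF Sc[OF Sc[OF e4]]] CS[OF Sc[OF e4]] CS[OF e4] l2.conjugation_scale[OF C e0, of "3/5"]
    unfolding h_def by simp
  then have h_eq: "3/5 * h i = ?T (?T (?T (C (unit 4)))) i" for i
    by (simp add: fun_eq_iff)
  have h0: "h i = 0" if "i \<noteq> 4" for i
    using h_eq[of i] that by (auto simp: shift_op_def split: if_splits)
  have "hs_inner (l2 N) h h = 1"
    using l2.conjugation_ip[OF C e0 e0] unfolding h_def inner_unit by (simp add: unit_def)
  then have h4: "h 4 * cnj (h 4) = 1"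
    by (subst (asm) inner_finite) (auto simp: h0)
  have "C (?T (?T (unit 0))) = ?S (?S h)"
    using CT[OF Tc[OF e0]] CT[OF e0] unfolding h_def by simp
  then have "hs_inner (l2 N) (?S (?S h)) (?S (?S h))
      = cnj (hs_inner (l2 N) (?T (?T (unit 0))) (?T (?T (unit 0))))"
    using l2.conjugation_ip[OF C Tc[OF Tc[OF e0]] Tc[OF Tc[OF e0]]] by simp
  also have "hs_inner (l2 N) (?T (?T (unit 0))) (?T (?T (unit 0))) = 1"
    by (subst inner_finite) (auto simp: shift_op_def unit_def)
  also have "hs_inner (l2 N) (?S (?S h)) (?S (?S h)) = 9/25 * (h 4 * cnj (h 4))"
    by (subst inner_finite) (auto simp: shift_adj_def h0)
  finally show False unfolding h4 by simp
qed

theorem theorem5p1: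
  shows
  "(\<forall>H :: 'a chspace. \<forall>T.
      hilbert_space H \<and> separable H \<and> partial_isometry H T \<and>
      hdim H (op_kernel H T) = hdim H (op_kernel H (adjoint H T)) \<and>
      hdim H (op_kernel H T) \<le> 1
      \<longrightarrow> complex_symmetric H T)
   \<and>
   (\<forall>H :: 'a chspace. \<forall>T.
      hilbert_space H \<and> separable H \<and> partial_isometry H T \<and>
      hdim H (op_kernel H T) \<noteq> hdim H (op_kernel H (adjoint H T))
      \<longrightarrow> \<not> complex_symmetric H T)
   \<and>
   (\<forall>n :: enat. 2 \<le> n \<longrightarrow>
      (\<exists>H :: (nat \<Rightarrow> complex) chspace. \<exists>T.
         hilbert_space H \<and> separable H \<and> partial_isometry H T \<and>
         hdim H (op_kernel H T) = n \<and> hdim H (op_kernel H (adjoint H T)) = n \<and>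
         complex_symmetric H T)
    \<and>
      (\<exists>H :: (nat \<Rightarrow> complex) chspace. \<exists>T.
         hilbert_space H \<and> separable H \<and> partial_isometry H T \<and>
         hdim H (op_kernel H T) = n \<and> hdim H (op_kernel H (adjoint H T)) = n \<and>
         \<not> complex_symmetric H T))"
proof (intro conjI allI impI)
  have hil: "complex_hilbert H" if "hilbert_space H" for H :: "'a chspace"
    using that by (simp add: complex_hilbert_def complex_ip_def complex_hilbert_axioms_def hilbert_space_def)
  show "complex_symmetric H T"
    if "hilbert_space H \<and> separable H \<and> partial_isometry H T \<and>
      hdim H (op_kernel H T) = hdim H (op_kernel H (adjoint H T)) \<and> hdim H (op_kernel H T) \<le> 1"
    for H :: "'a chspace" and T
    using that complex_hilbert.partial_isometry_small_kernel[OF hil] by blast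
  show "\<not> complex_symmetric H T"
    if "hilbert_space H \<and> separable H \<and> partial_isometry H T \<and>
      hdim H (op_kernel H T) \<noteq> hdim H (op_kernel H (adjoint H T))"
    for H :: "'a chspace" and T
    using that complex_hilbert.complex_symmetric_hdim_kernel[OF hil] unfolding partial_isometry_def
    by blast
  fix n :: enat assume n: "2 \<le> n"
  show "\<exists>H :: (nat \<Rightarrow> complex) chspace. \<exists>T.
         hilbert_space H \<and> separable H \<and> partial_isometry H T \<and>
         hdim H (op_kernel H T) = n \<and> hdim H (op_kernel H (adjoint H T)) = n \<and>
         complex_symmetric H T"
    using hilbert_space_l2 separable_l2 zero_op_example by blast
  \<comment> \<open>The bound on \<open>n\<close> is exactly what makes room for the
    five-dimensional block.\<close>
  have N: "5 \<le> n + 3" using n by (cases n) (auto simp: numeral_eq_enat)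
  have "hdim (l2 (n + 3)) (op_kernel (l2 (n + 3)) (adjoint (l2 (n + 3)) shift_op)) = n"
    unfolding l2.adj_pair_op_kernel[OF shift_adj_pair[OF N]] by (rule hdim_kernel_shift_adj[OF n])
  then show "\<exists>H :: (nat \<Rightarrow> complex) chspace. \<exists>T.
         hilbert_space H \<and> separable H \<and> partial_isometry H T \<and>
         hdim H (op_kernel H T) = n \<and> hdim H (op_kernel H (adjoint H T)) = n \<and>
         \<not> complex_symmetric H T"
    using hilbert_space_l2 separable_l2 shift_partial_isometry[OF N] hdim_kernel_shift[of n]
      shift_not_complex_symmetric[OF N] by blast
qed

end
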